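(* Let $0\le \varepsilon<1$, let $\pi$ be a private coin protocol with inputs $(X,Y)\sim \mathrm{P}_{XY}$ and transcript $\Pi$, and let $0<\eta<1/3$ be arbitrary. Let $\lambda_{\min}^{(i)}\le \lambda_{\max}^{(i)}$, $i=1,2,3$, be real numbers and $\varepsilon_{\mathrm{tail}}\ge 0$ such that, with $\zeta_1=h(X,Y)$, $\zeta_2=h(X|Y\Pi)$, $\zeta_3=h(X\Pi\triangle Y\Pi)$ and $\mathcal{E}_i=\{\zeta_i\notin[\lambda_{\min}^{(i)},\lambda_{\max}^{(i)}]\}$, $$\Pr(\mathcal{E}_1)+\Pr(\mathcal{E}_2)+\Pr(\mathcal{E}_3)\le \varepsilon_{\mathrm{tail}} .$$ Put $\Lambda_i=\lambda_{\max}^{(i)}-\lambda_{\min}^{(i)}$, except that $\Lambda_i$ is replaced by $1$ if this difference equals $0$; put $\varepsilon'=\varepsilon_{\mathrm{tail}}+2\eta$, and $$\lambda'=2\log(\Lambda_1\Lambda_3)+\log\Lambda_2-\log(1-3\eta)+9\log(1/\eta)+3 .$$ Then $$D_\varepsilon(\pi)\ \ge\ \sup\{\lambda:\ \Pr(\mathrm{ic}(\Pi;X,Y)>\lambda)\ge \varepsilon+\varepsilon'\}-\lambda' ,$$ where the supremum of the empty set is $-\infty$.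
   Context: All logarithms are to base 2. $X$ and $Y$ are random variables with values in finite sets $\mathcal{X},\mathcal{Y}$ and fixed joint distribution $\mathrm{P}_{XY}$. Party 1 observes $X$ and Party 2 observes $Y$. Interactive protocol. An interactive protocol uses shared public randomness $U$ and private randomness $U_{\mathcal{X}}$ (Party 1) and $U_{\mathcal{Y}}$ (Party 2), where $U,U_{\mathcal{X}},U_{\mathcal{Y}}$ are mutually independent and jointly independent of $(X,Y)$. Party 1 sends messages in odd rounds, Party 2 in even rounds. In round $i$ the communicating party sends a bit string $\Pi_i\in\{0,1\}^*$ determined by the previous messages $\Pi^{i-1}=(\Pi_1,\dots,\Pi_{i-1})$ and that party's observations ($(X,U_{\mathcal{X}},U)$ for Party 1, $(Y,U_{\mathcal{Y}},U)$ for Party 2). Each possible value of $\Pi_i$ is associated with a next state: "continue" (the other party sends the next message) or "stop" (the protocol ends). The set $\mathcal{C}_i$ of possible values of $\Pi_i$ and the associated next states are determined by a common function, i.e., by a random variable $V$ with $H(V|X,U_{\mathcal{X}},U,\Pi^{i-1})=H(V|Y,U_{\mathcal{Y}},U,\Pi^{i-1})=0$. The transcript $\Pi$ is the sequence of all messages. The length $|\pi|$ of a protocol $\pi$ is the maximum number of bits communicated in any execution. A private coin protocol is one with $U$ constant. A random variable $F$ is recoverable by $\pi$ for Party 1 (Party 2) if $F$ is a function of $(X,U,U_{\mathcal{X}},\Pi)$ (of $(Y,U,U_{\mathcal{Y}},\Pi)$). Simulation. For a private coin protocol $\pi$ with transcript $\Pi$ and $0\le\varepsilon<1$, a protocol $\pi_{\mathrm{sim}}$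 (public and private randomness allowed) is an $\varepsilon$-simulation of $\pi$ if there are $\Pi_{\mathcal{X}}$ and $\Pi_{\mathcal{Y}}$, recoverable by $\pi_{\mathrm{sim}}$ for Party 1 and Party 2 respectively, with $d_{\mathrm{var}}(\mathrm{P}_{\Pi\Pi XY},\mathrm{P}_{\Pi_{\mathcal{X}}\Pi_{\mathcal{Y}}XY})\le\varepsilon$, where $d_{\mathrm{var}}(\mathrm{P},\mathrm{Q})=\frac12\sum_x|\mathrm{P}(x)-\mathrm{Q}(x)|$ and $\mathrm{P}_{\Pi\Pi XY}$ is the law of $(\Pi,\Pi,X,Y)$. $D_\varepsilon(\pi)$ is the minimum length of an $\varepsilon$-simulation of $\pi$. Information complexity density: $\mathrm{ic}(\tau;x,y)=\log\frac{\mathrm{P}_{\Pi|XY}(\tau|x,y)}{\mathrm{P}_{\Pi|X}(\tau|x)}+\log\frac{\mathrm{P}_{\Pi|XY}(\tau|x,y)}{\mathrm{P}_{\Pi|Y}(\tau|y)}$, and $\mathrm{ic}(\Pi;X,Y)$ is the random variable obtained by evaluating it at $(\Pi,X,Y)$. Other densities (random variables): $h(X,Y)=-\log \mathrm{P}_{XY}(X,Y)$; $h(X|Y\Pi)=-\log\mathrm{P}_{X|Y\Pi}(X|Y,\Pi)$; $h(X\Pi\triangle Y\Pi)=-\log\left[\mathrm{P}_{X|Y\Pi}(X|Y,\Pi)\,\mathrm{P}_{Y|X\Pi}(Y|X,\Pi)\right]$.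
   Formalization: Simulating protocols must use prefix-free message sets (otherwise two bits always suffice); Λ_i is replaced by 1 whenever the difference is below 1, not only when it is 0 (tiny windows break the bound); simulators' coins are real-valued (no loss, as only countably many coin events matter). *)

theory Defs
  imports "HOL-Probability.Probability" "HOL-Library.Sublist"
begin

type_synonym message = "bool list"
type_synonym transcript = "message list"

datatype next_state = Continue | Stop

text \<open>
  A codebook \<open>c\<close> gives the set of possible messages \<open>dom c\<close> of a round together with the next state
  attached to each of them.

  In a protocol, \<open>msg1\<close> and \<open>msg2\<close> map the observations of a party (input, private coin, public
  coin) and the previous messages to its next message. The codebook of a round has to be a common
  function of the two parties' observations: \<open>code1\<close> and \<open>code2\<close> are the codebook as computed by
  the one and by the other party, and \<open>interactive_protocol\<close> below demands that they agree
  almost surely. That is the condition that both conditional entropies of \<open>V\<close> vanish, for \<open>V\<close>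
  the codebook itself.
\<close>

type_synonym codebook = "message \<rightharpoonup> next_state"

record ('x, 'y, 'u, 'a, 'b) protocol =
  pub :: "'u measure"
  priv1 :: "'a measure"
  priv2 :: "'b measure"
  msg1 :: "'x \<Rightarrow> 'a \<Rightarrow> 'u \<Rightarrow> transcript \<Rightarrow> message"
  msg2 :: "'y \<Rightarrow> 'b \<Rightarrow> 'u \<Rightarrow> transcript \<Rightarrow> message"
  code1 :: "'x \<Rightarrow> 'a \<Rightarrow> 'u \<Rightarrow> transcript \<Rightarrow> codebook"
  code2 :: "'y \<Rightarrow> 'b \<Rightarrow> 'u \<Rightarrow> transcript \<Rightarrow> codebook"

type_synonym ('x, 'y, 'u, 'a, 'b) outcome = "('x \<times> 'y) \<times> 'u \<times> 'a \<times> 'b"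

text \<open>The product measure encodes that the inputs (as a pair) and the three coins are independent.\<close>

definition exec_space ::
  "('x \<times> 'y) pmf \<Rightarrow> ('x, 'y, 'u, 'a, 'b) protocol \<Rightarrow> ('x, 'y, 'u, 'a, 'b) outcome measure" where
  "exec_space P p = measure_pmf P \<Otimes>\<^sub>M (pub p \<Otimes>\<^sub>M (priv1 p \<Otimes>\<^sub>M priv2 p))"

fun inX :: "('x, 'y, 'u, 'a, 'b) outcome \<Rightarrow> 'x" where "inX ((x, y), u, a, b) = x"
fun inY :: "('x, 'y, 'u, 'a, 'b) outcome \<Rightarrow> 'y" where "inY ((x, y), u, a, b) = y"
fun coinU :: "('x, 'y, 'u, 'a, 'b) outcome \<Rightarrow> 'u" where "coinU ((x, y), u, a, b) = u"
fun coin1 :: "('x, 'y, 'u, 'a, 'b) outcome \<Rightarrow> 'a" where "coin1 ((x, y), u, a, b) = a"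
fun coin2 :: "('x, 'y, 'u, 'a, 'b) outcome \<Rightarrow> 'b" where "coin2 ((x, y), u, a, b) = b"

text \<open>Round \<open>i\<close> is the one with \<open>i - 1\<close> previous messages, so Party 1 speaks when their number is even.\<close>

definition message ::
  "('x, 'y, 'u, 'a, 'b) protocol \<Rightarrow> ('x, 'y, 'u, 'a, 'b) outcome \<Rightarrow> transcript \<Rightarrow> message" where
  "message p \<omega> h =
     (if even (length h) then msg1 p (inX \<omega>) (coin1 \<omega>) (coinU \<omega>) h
      else msg2 p (inY \<omega>) (coin2 \<omega>) (coinU \<omega>) h)"

definition view1 ::
  "('x, 'y, 'u, 'a, 'b) protocol \<Rightarrow> ('x, 'y, 'u, 'a, 'b) outcome \<Rightarrow> transcript \<Rightarrow> codebook" where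
  "view1 p \<omega> h = code1 p (inX \<omega>) (coin1 \<omega>) (coinU \<omega>) h"

definition view2 ::
  "('x, 'y, 'u, 'a, 'b) protocol \<Rightarrow> ('x, 'y, 'u, 'a, 'b) outcome \<Rightarrow> transcript \<Rightarrow> codebook" where
  "view2 p \<omega> h = code2 p (inY \<omega>) (coin2 \<omega>) (coinU \<omega>) h"

text \<open>The first \<open>n\<close> messages; meaningful only as long as the protocol has not stopped before.\<close>

primrec history ::
  "('x, 'y, 'u, 'a, 'b) protocol \<Rightarrow> ('x, 'y, 'u, 'a, 'b) outcome \<Rightarrow> nat \<Rightarrow> transcript" where
  "history p \<omega> 0 = []"
| "history p \<omega> (Suc n) = history p \<omega> n @ [message p \<omega> (history p \<omega> n)]"

text \<open>Round \<open>n + 1\<close> ends in state \<open>Stop\<close>. Using \<open>view1\<close> here is no loss: in an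
  \<open>interactive_protocol\<close> the two views agree almost surely.\<close>

definition stops ::
  "('x, 'y, 'u, 'a, 'b) protocol \<Rightarrow> ('x, 'y, 'u, 'a, 'b) outcome \<Rightarrow> nat \<Rightarrow> bool" where
  "stops p \<omega> n \<longleftrightarrow>
     view1 p \<omega> (history p \<omega> n) (message p \<omega> (history p \<omega> n)) = Some Stop"

text \<open>Round \<open>n + 1\<close> takes place.\<close>

definition running ::
  "('x, 'y, 'u, 'a, 'b) protocol \<Rightarrow> ('x, 'y, 'u, 'a, 'b) outcome \<Rightarrow> nat \<Rightarrow> bool" where
  "running p \<omega> n \<longleftrightarrow> (\<forall>k<n. \<not> stops p \<omega> k)"

definition transcript_of ::
  "('x, 'y, 'u, 'a, 'b) protocol \<Rightarrow> ('x, 'y, 'u, 'a, 'b) outcome \<Rightarrow> transcript" where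
  "transcript_of p \<omega> = history p \<omega> (Suc (LEAST n. stops p \<omega> n))"

definition interactive_protocol ::
  "('x \<times> 'y) pmf \<Rightarrow> ('x, 'y, 'u, 'a, 'b) protocol \<Rightarrow> bool" where
  "interactive_protocol P p \<longleftrightarrow>
     prob_space (pub p) \<and> prob_space (priv1 p) \<and> prob_space (priv2 p) \<and>
     (\<forall>x h. (\<lambda>(a, u). msg1 p x a u h) \<in> measurable (priv1 p \<Otimes>\<^sub>M pub p) (count_space UNIV)) \<and>
     (\<forall>y h. (\<lambda>(b, u). msg2 p y b u h) \<in> measurable (priv2 p \<Otimes>\<^sub>M pub p) (count_space UNIV)) \<and>
     (\<forall>x h m. (\<lambda>(a, u). code1 p x a u h m) \<in> measurable (priv1 p \<Otimes>\<^sub>M pub p) (count_space UNIV)) \<and>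
     (\<forall>y h m. (\<lambda>(b, u). code2 p y b u h m) \<in> measurable (priv2 p \<Otimes>\<^sub>M pub p) (count_space UNIV)) \<and>
     (AE \<omega> in exec_space P p. \<forall>n. running p \<omega> n \<longrightarrow>
        view1 p \<omega> (history p \<omega> n) = view2 p \<omega> (history p \<omega> n) \<and>
        message p \<omega> (history p \<omega> n) \<in> dom (view1 p \<omega> (history p \<omega> n))) \<and>
     (AE \<omega> in exec_space P p. \<exists>n. stops p \<omega> n)"

definition private_coin :: "('x, 'y, 'u, 'a, 'b) protocol \<Rightarrow> bool" where
  "private_coin p \<longleftrightarrow> (\<exists>c. AE u in pub p. u = c)"

definition prefix_free :: "message set \<Rightarrow> bool" where
  "prefix_free C \<longleftrightarrow> (\<forall>m\<in>C. \<forall>m'\<in>C. prefix m m' \<longrightarrow> m = m')"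

text \<open>
  The bits of a message tell where it ends. Only then does counting bits measure communication:
  with possible messages \<open>{[], [False]}\<close> in every round, the index of the round in which the
  single bit is sent would convey an arbitrary amount of information in one bit.
\<close>

definition self_delimiting ::
  "('x \<times> 'y) pmf \<Rightarrow> ('x, 'y, 'u, 'a, 'b) protocol \<Rightarrow> bool" where
  "self_delimiting P p \<longleftrightarrow>
     (AE \<omega> in exec_space P p. \<forall>n. running p \<omega> n \<longrightarrow>
        prefix_free (dom (view1 p \<omega> (history p \<omega> n))))"

text \<open>The maximum over all executions, up to probability zero; \<open>\<infinity>\<close> if there is no bound.\<close>

definition protocol_length ::
  "('x \<times> 'y) pmf \<Rightarrow> ('x, 'y, 'u, 'a, 'b) protocol \<Rightarrow> enat" where
  "protocol_length P p =
     Inf {enat l | l. AE \<omega> in exec_space P p. length (concat (transcript_of p \<omega>)) \<le> l}"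

definition recoverable1 ::
  "('x \<times> 'y) pmf \<Rightarrow> ('x, 'y, 'u, 'a, 'b) protocol \<Rightarrow>
   (('x, 'y, 'u, 'a, 'b) outcome \<Rightarrow> 'f) \<Rightarrow> bool" where
  "recoverable1 P p F \<longleftrightarrow> F \<in> measurable (exec_space P p) (count_space UNIV) \<and>
     (\<exists>g. (\<forall>x t. (\<lambda>(a, u). g x u a t) \<in> measurable (priv1 p \<Otimes>\<^sub>M pub p) (count_space UNIV)) \<and>
          (AE \<omega> in exec_space P p.
             F \<omega> = g (inX \<omega>) (coinU \<omega>) (coin1 \<omega>) (transcript_of p \<omega>)))"

definition recoverable2 ::
  "('x \<times> 'y) pmf \<Rightarrow> ('x, 'y, 'u, 'a, 'b) protocol \<Rightarrow>
   (('x, 'y, 'u, 'a, 'b) outcome \<Rightarrow> 'f) \<Rightarrow> bool" where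
  "recoverable2 P p F \<longleftrightarrow> F \<in> measurable (exec_space P p) (count_space UNIV) \<and>
     (\<exists>g. (\<forall>y t. (\<lambda>(b, u). g y u b t) \<in> measurable (priv2 p \<Otimes>\<^sub>M pub p) (count_space UNIV)) \<and>
          (AE \<omega> in exec_space P p.
             F \<omega> = g (inY \<omega>) (coinU \<omega>) (coin2 \<omega>) (transcript_of p \<omega>)))"

text \<open>Variational distance of discrete distributions.\<close>

definition d_var :: "'s measure \<Rightarrow> 's measure \<Rightarrow> real" where
  "d_var P Q = (1 / 2) * (\<Sum>\<^sub>\<infinity>z. \<bar>measure P {z} - measure Q {z}\<bar>)"

definition simulates ::
  "('x \<times> 'y) pmf \<Rightarrow> ('x, 'y, 'u, 'a, 'b) protocol \<Rightarrow> real \<Rightarrow>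
   ('x, 'y, 'v, 'c, 'd) protocol \<Rightarrow> bool" where
  "simulates P p \<epsilon> s \<longleftrightarrow>
     interactive_protocol P s \<and> self_delimiting P s \<and>
     (\<exists>F1 F2. recoverable1 P s F1 \<and> recoverable2 P s F2 \<and>
        d_var
          (distr (exec_space P p) (count_space UNIV)
             (\<lambda>\<omega>. (transcript_of p \<omega>, transcript_of p \<omega>, inX \<omega>, inY \<omega>)))
          (distr (exec_space P s) (count_space UNIV)
             (\<lambda>\<omega>. (F1 \<omega>, F2 \<omega>, inX \<omega>, inY \<omega>))) \<le> \<epsilon>)"

text \<open>
  The coins of the simulating protocols live on arbitrary probability spaces over the reals; up to
  isomorphism this covers all discrete and all standard Borel coins. The infimum is a minimum
  because \<open>enat\<close> is well-ordered.
\<close>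

definition D_sim ::
  "('x \<times> 'y) pmf \<Rightarrow> ('x, 'y, 'u, 'a, 'b) protocol \<Rightarrow> real \<Rightarrow> enat" where
  "D_sim P p \<epsilon> =
     Inf {protocol_length P s | s :: ('x, 'y, real, real, real) protocol. simulates P p \<epsilon> s}"

definition ic ::
  "('x \<times> 'y) pmf \<Rightarrow> ('x, 'y, 'u, 'a, 'b) protocol \<Rightarrow> transcript \<Rightarrow> 'x \<Rightarrow> 'y \<Rightarrow> real" where
  "ic P p t x y =
     (let M = exec_space P p;
          pXY = \<P>(\<omega> in M. transcript_of p \<omega> = t \<bar> inX \<omega> = x \<and> inY \<omega> = y);
          pX = \<P>(\<omega> in M. transcript_of p \<omega> = t \<bar> inX \<omega> = x);
          pY = \<P>(\<omega> in M. transcript_of p \<omega> = t \<bar> inY \<omega> = y)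
      in log 2 (pXY / pX) + log 2 (pXY / pY))"

definition h_XY :: "('x \<times> 'y) pmf \<Rightarrow> 'x \<Rightarrow> 'y \<Rightarrow> real" where
  "h_XY P x y = - log 2 (pmf P (x, y))"

definition h_X_given ::
  "('x \<times> 'y) pmf \<Rightarrow> ('x, 'y, 'u, 'a, 'b) protocol \<Rightarrow> transcript \<Rightarrow> 'x \<Rightarrow> 'y \<Rightarrow> real" where
  "h_X_given P p t x y =
     - log 2 \<P>(\<omega> in exec_space P p. inX \<omega> = x \<bar> inY \<omega> = y \<and> transcript_of p \<omega> = t)"

definition h_sym_diff ::
  "('x \<times> 'y) pmf \<Rightarrow> ('x, 'y, 'u, 'a, 'b) protocol \<Rightarrow> transcript \<Rightarrow> 'x \<Rightarrow> 'y \<Rightarrow> real" where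
  "h_sym_diff P p t x y =
     - log 2 (\<P>(\<omega> in exec_space P p. inX \<omega> = x \<bar> inY \<omega> = y \<and> transcript_of p \<omega> = t) *
              \<P>(\<omega> in exec_space P p. inY \<omega> = y \<bar> inX \<omega> = x \<and> transcript_of p \<omega> = t))"

definition at_outcome ::
  "('x, 'y, 'u, 'a, 'b) protocol \<Rightarrow> (transcript \<Rightarrow> 'x \<Rightarrow> 'y \<Rightarrow> real) \<Rightarrow>
   ('x, 'y, 'u, 'a, 'b) outcome \<Rightarrow> real" where
  "at_outcome p f \<omega> = f (transcript_of p \<omega>) (inX \<omega>) (inY \<omega>)"

text \<open>
  The length of a spectral window, where a degenerate window counts as \<open>1\<close>. Windows of length
  strictly between \<open>0\<close> and \<open>1\<close> are treated like those of length \<open>0\<close>: as any window can be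
  enlarged by an arbitrarily small amount, the logarithm of such a length could otherwise be made
  arbitrarily negative without changing any probability.
\<close>

definition window :: "real \<Rightarrow> real \<Rightarrow> real" where
  "window lmin lmax = (if lmax - lmin < 1 then 1 else lmax - lmin)"

end

theory Submission
  imports Defs
begin

text \<open>
  Write $\tau$ for the transcript of $\pi$ and $a(x), b(y)$ for the probabilities that the coins of
  the parties of a simulation are consistent with one of its transcripts $t$ and lead to the
  reconstruction $\tau$. The joint probability of $(t, \tau, x, y)$ is
  $m = P(x, y)\, a(x)\, b(y)$, and $a, b \le 1$ together with the definition of the information
  complexity density yields $m \le 2^{-ic/2} \sqrt{p q}$, where $p = P(x)\, a(x)\, P(y|x, \tau)$ and
  $q = P(y)\, b(y)\, P(x|y, \tau)$. By the Cauchy-Schwarz inequality, summing $\sqrt{p q}$ over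
  $(\tau, x, y)$ gives at most the geometric mean of the probabilities of $t$ for the
  two parties under the product of the marginals, and Kraft's inequality bounds the sum of these
  geometric means over all $t$ of at most $L$ bits by $2^{L/2}$. Hence a simulation of $L$ bits
  reproduces transcripts with $ic > \lambda$ with probability at most $2^{(L-\lambda)/2}$, which
  gives $L \ge \lambda - 2 \log(1/\eta)$, where $\lambda' \ge 2 \log(1/\eta)$.
\<close>

section \<open>Inequalities of Cauchy-Schwarz and Kraft\<close>

text \<open>Cauchy-Schwarz for vectors of square roots. It serves three times: for the triples in
  \<open>E\<close>, for the messages of a round and for the codebooks of a round.\<close>

lemma sum_sqrt_mult_le:
  fixes a b :: "'i \<Rightarrow> real"
  assumes "\<And>i. i \<in> I \<Longrightarrow> 0 \<le> a i" "\<And>i. i \<in> I \<Longrightarrow> 0 \<le> b i"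
  shows "(\<Sum>i\<in>I. sqrt (a i) * sqrt (b i)) \<le> sqrt (sum a I) * sqrt (sum b I)"
proof -
  have "(\<Sum>i\<in>I. sqrt (a i) * sqrt (b i)) = (\<Sum>i\<in>I. \<bar>sqrt (a i)\<bar> * \<bar>sqrt (b i)\<bar>)"
    using assms by (intro sum.cong) auto
  also have "\<dots> \<le> L2_set (\<lambda>i. sqrt (a i)) I * L2_set (\<lambda>i. sqrt (b i)) I"
    by (rule L2_set_mult_ineq)
  also have "\<dots> = sqrt (sum a I) * sqrt (sum b I)"
    unfolding L2_set_def using assms by (auto intro!: arg_cong2[where f = "(*)"] arg_cong[where f = sqrt] sum.cong)
  finally show ?thesis .
qed

text \<open>Induction on the length bound. If the empty word is in \<open>D\<close>, prefix-freeness
  makes it the only one. Otherwise \<open>D\<close> splits by the first bit into two sets, each of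
  which stays prefix-free once that bit is removed and contributes half of its own sum.\<close>

lemma kraft_inequality:
  assumes "prefix_free D" "\<And>m. m \<in> D \<Longrightarrow> length m \<le> N"
  shows "(\<Sum>m\<in>D. (1 / 2) ^ length m) \<le> (1 :: real)"
  using assms
proof (induction N arbitrary: D)
  case 0
  then have "D \<subseteq> {[]}" by auto
  then have "D = {} \<or> D = {[]}" by blast
  then show ?case by auto
next
  case (Suc N)
  show ?case
  proof (cases "[] \<in> D")
    case True
    have "m = []" if "m \<in> D" for m
      using Suc.prems(1)[unfolded prefix_free_def, rule_format, OF True that] by simp
    with True have "D = {[]}" by blast
    then show ?thesis by simp
  next
    case False
    define T where "T b = {m. b # m \<in> D}" for b
    have D: "D = (#) True ` T True \<union> (#) False ` T False"
    proof
      show "D \<subseteq> (#) True ` T True \<union> (#) False ` T False"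
      proof
        fix m assume "m \<in> D"
        with False obtain b m' where "m = b # m'" "m' \<in> T b"
          by (cases m) (simp_all add: T_def)
        then show "m \<in> (#) True ` T True \<union> (#) False ` T False"
          by (cases b) simp_all
      qed
    qed (auto simp: T_def)
    have len: "length m \<le> N" if "m \<in> T b" for m b
      using Suc.prems(2)[of "b # m"] that by (simp add: T_def)
    have free: "prefix_free (T b)" for b
      unfolding prefix_free_def
    proof (intro ballI impI)
      fix m m' assume "m \<in> T b" "m' \<in> T b" "prefix m m'"
      then have "b # m = b # m'"
        using Suc.prems(1)[unfolded prefix_free_def, rule_format, of "b # m" "b # m'"] by (simp add: T_def)
      then show "m = m'" by simp
    qed
    have le: "(\<Sum>m\<in>T b. (1 / 2) ^ length m) \<le> (1 :: real)" for b
      using free len by (rule Suc.IH)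
    have fin: "finite (T b)" for b
      by (rule finite_subset[OF _ finite_lists_length_le[of "UNIV :: bool set" N]]) (auto dest: len)
    have "(\<Sum>m\<in>D. (1 / 2) ^ length m) =
        (\<Sum>m\<in>(#) True ` T True. (1 / 2) ^ length m) + (\<Sum>m\<in>(#) False ` T False. (1 / 2 :: real) ^ length m)"
      unfolding D by (rule sum.union_disjoint) (auto simp: fin)
    also have "\<dots> = (1 / 2) * (\<Sum>m\<in>T True. (1 / 2) ^ length m) + (1 / 2) * (\<Sum>m\<in>T False. (1 / 2) ^ length m)"
      by (simp add: sum.reindex inj_on_def sum_distrib_left)
    also have "\<dots> \<le> 1" using le[of True] le[of False] by simp
    finally show ?thesis .
  qed
qed

lemma (in finite_measure) sum_measure_le_disjoint:
  assumes "finite I" "disjoint_family_on F I" "\<And>i. i \<in> I \<Longrightarrow> F i \<in> sets M"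
    "\<And>i. i \<in> I \<Longrightarrow> F i \<subseteq> S" "S \<in> sets M"
  shows "(\<Sum>i\<in>I. measure M (F i)) \<le> measure M S"
proof -
  have "(\<Sum>i\<in>I. measure M (F i)) = measure M (\<Union>i\<in>I. F i)"
    using assms by (intro finite_measure_finite_Union[symmetric]) auto
  also have "\<dots> \<le> measure M S" using assms by (intro finite_measure_mono) auto
  finally show ?thesis .
qed

section \<open>Executions within a budget of rounds and bits\<close>

definition short :: "nat \<Rightarrow> message set" where
  "short l = {m. length m \<le> l}"

lemma finite_short [simp]: "finite (short l)"
  unfolding short_def using finite_lists_length_le[of "UNIV :: bool set" l] by simp

text \<open>
  The parties, whose coins and inputs are fixed, continue from the history \<open>h\<close> and stop within \<open>n\<close>
  rounds and \<open>l\<close> bits at a transcript that satisfies \<open>G\<close>. Codebooks are compared only on messages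
  of at most \<open>l\<close> bits, so that finitely many of them have to be distinguished.
\<close>

primrec succeeds ::
  "(transcript \<Rightarrow> codebook) \<Rightarrow> (transcript \<Rightarrow> codebook) \<Rightarrow> (transcript \<Rightarrow> message) \<Rightarrow>
   (transcript \<Rightarrow> message) \<Rightarrow> (transcript \<Rightarrow> bool) \<Rightarrow> nat \<Rightarrow> nat \<Rightarrow> transcript \<Rightarrow> bool" where
  "succeeds c1 c2 m1 m2 G 0 l h \<longleftrightarrow> False"
| "succeeds c1 c2 m1 m2 G (Suc n) l h \<longleftrightarrow>
     (\<forall>m\<in>short l. c1 h m = c2 h m) \<and>
     (\<forall>m\<in>short l. \<forall>m'\<in>short l. prefix m m' \<and> m \<noteq> m' \<longrightarrow> c1 h m = None \<or> c1 h m' = None) \<and>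
     (\<exists>m\<in>short l. (if even (length h) then m1 h else m2 h) = m \<and>
        (c1 h m = Some Stop \<and> G (h @ [m]) \<or>
         c1 h m = Some Continue \<and> succeeds c1 c2 m1 m2 G n (l - length m) (h @ [m])))"

text \<open>\<open>succeeds\<close> occurs only positively in its own recursion, so an implication
  between two round bounds survives one more round.\<close>

lemma succeeds_mono:
  assumes "\<And>l h. succeeds c1 c2 m1 m2 G n l h \<Longrightarrow> succeeds c1 c2 m1 m2 G n' l h"
    and "succeeds c1 c2 m1 m2 G (Suc n) l h"
  shows "succeeds c1 c2 m1 m2 G (Suc n') l h"
  using assms(2) unfolding succeeds.simps
proof (elim conjE, intro conjI)
  assume "\<exists>m\<in>short l. (if even (length h) then m1 h else m2 h) = m \<and>
        (c1 h m = Some Stop \<and> G (h @ [m]) \<or>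
         c1 h m = Some Continue \<and> succeeds c1 c2 m1 m2 G n (l - length m) (h @ [m]))"
    (is "\<exists>m\<in>_. ?sent m \<and> (?S m \<or> ?C m \<and> ?R m)")
  then obtain m where "m \<in> short l" "?sent m" "?S m \<or> ?C m \<and> ?R m" by (elim bexE conjE)
  then show "\<exists>m\<in>short l. ?sent m \<and> (?S m \<or> ?C m \<and> succeeds c1 c2 m1 m2 G n' (l - length m) (h @ [m]))"
    using assms(1)[of "l - length m" "h @ [m]"] by (intro bexI[of _ m]) (rule conjI, assumption, argo)
qed assumption+

text \<open>With this, the events of success within \<open>n\<close> rounds increase with
  \<open>n\<close>, and their union can be reached by a limit.\<close>

lemma succeeds_Suc: "succeeds c1 c2 m1 m2 G n l h \<Longrightarrow> succeeds c1 c2 m1 m2 G (Suc n) l h"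
proof (induction n arbitrary: l h)
  case (Suc n)
  from succeeds_mono[OF Suc.IH Suc.prems] show ?case .
qed simp

text \<open>An optional state has only three values, which reduces equality to a finite disjunction
  of conditions on the single functions.\<close>

lemma pred_eq_next_state_option:
  fixes f g :: "'a \<Rightarrow> next_state option"
  assumes [measurable]: "f \<in> measurable M (count_space UNIV)" "g \<in> measurable M (count_space UNIV)"
  shows "Measurable.pred M (\<lambda>x. f x = g x)"
proof -
  have "f x = g x \<longleftrightarrow> (f x = None \<and> g x = None) \<or> (f x = Some Stop \<and> g x = Some Stop) \<or>
      (f x = Some Continue \<and> g x = Some Continue)" for x
    by (cases "f x"; cases "g x"; cases "the (f x)"; cases "the (g x)") auto
  then show ?thesis by (simp only:) measurable
qed

text \<open>The message sent enters \<open>succeeds\<close> through a quantifier over the finite set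
  \<open>short l\<close>. Measurability at each fixed history and message therefore suffices, and no
  random history has to be substituted.\<close>

lemma pred_succeeds [measurable (raw)]:
  assumes [measurable]:
      "\<And>h m. (\<lambda>\<omega>. c1 \<omega> h m) \<in> measurable M (count_space UNIV)"
      "\<And>h m. (\<lambda>\<omega>. c2 \<omega> h m) \<in> measurable M (count_space UNIV)"
      "\<And>h. (\<lambda>\<omega>. m1 \<omega> h) \<in> measurable M (count_space UNIV)"
      "\<And>h. (\<lambda>\<omega>. m2 \<omega> h) \<in> measurable M (count_space UNIV)"
      "\<And>t. Measurable.pred M (\<lambda>\<omega>. G \<omega> t)"
  shows "Measurable.pred M (\<lambda>\<omega>. succeeds (c1 \<omega>) (c2 \<omega>) (m1 \<omega>) (m2 \<omega>) (G \<omega>) n l h)"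
proof (induction n arbitrary: l h)
  case (Suc n)
  note [measurable] = Suc.IH
  have [measurable]: "Measurable.pred M (\<lambda>\<omega>. c1 \<omega> h m = c2 \<omega> h m)" for m
    by (rule pred_eq_next_state_option) measurable
  show ?case unfolding succeeds.simps by measurable
qed simp

section \<open>Weighted Kraft inequality and bounded codebooks\<close>

text \<open>Estimate for one round: a message \<open>m\<close> leaves \<open>l - length m\<close>
  bits, and \<open>s m\<close> is the mass of the speaker's coins that choose it. Factoring out
  \<open>sqrt 2 ^ l\<close> turns the powers into square roots of Kraft weights; Cauchy-Schwarz then
  separates the Kraft sum, at most 1, from the total mass.\<close>

lemma kraft_sqrt_sum_le:
  fixes s :: "message \<Rightarrow> real"
  assumes D: "prefix_free D" "\<And>m. m \<in> D \<Longrightarrow> length m \<le> l"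
    and s: "\<And>m. m \<in> D \<Longrightarrow> 0 \<le> s m" "sum s D \<le> s0"
  shows "(\<Sum>m\<in>D. sqrt 2 ^ (l - length m) * sqrt (s m)) \<le> sqrt 2 ^ l * sqrt s0"
proof -
  \<comment> \<open>Subtraction of natural numbers is exact here because no message of
    \<open>D\<close> is longer than \<open>l\<close>.\<close>
  have pow: "sqrt 2 ^ (l - length m) = sqrt 2 ^ l * sqrt ((1 / 2) ^ length m)" if "m \<in> D" for m
    using D(2)[OF that] by (simp add: real_sqrt_power power_diff power_one_over real_sqrt_divide)
  have "(\<Sum>m\<in>D. sqrt 2 ^ (l - length m) * sqrt (s m)) =
      sqrt 2 ^ l * (\<Sum>m\<in>D. sqrt ((1 / 2) ^ length m) * sqrt (s m))"
    by (simp add: sum_distrib_left pow algebra_simps cong: sum.cong)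
  also have "\<dots> \<le> sqrt 2 ^ l * (sqrt (\<Sum>m\<in>D. (1 / 2) ^ length m) * sqrt (sum s D))"
    by (intro mult_left_mono sum_sqrt_mult_le s) auto
  also have "\<dots> \<le> sqrt 2 ^ l * (sqrt 1 * sqrt s0)"
    using kraft_inequality[OF D] s
    by (intro mult_left_mono mult_mono) (auto intro!: sum_nonneg)
  finally show ?thesis by simp
qed

text \<open>The possible values of a codebook after restriction to messages of at most
  \<open>l\<close> bits. They are finitely many, so the coins can be partitioned by the
  value.\<close>

definition codes :: "nat \<Rightarrow> codebook set" where
  "codes l = {v. dom v \<subseteq> short l \<and> prefix_free (dom v)}"

lemma finite_codes: "finite (codes l)"
proof -
  have "(UNIV :: next_state set) = {Continue, Stop}" using next_state.exhaust by blast
  then have "finite (UNIV :: next_state set)" by (metis finite.simps)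
  then have "finite (\<Union>D\<in>Pow (short l). {v. dom v = D \<and> ran v \<subseteq> (UNIV :: next_state set)})"
    by (intro finite_UN_I finite_set_of_finite_maps) (auto intro: finite_subset[OF _ finite_short])
  then show ?thesis
    by (rule finite_subset[rotated]) (auto simp: codes_def)
qed

section \<open>A simulation with fixed public coin as a guessing game\<close>

text \<open>
  A simulation with its public coin fixed. The weights \<open>r1\<close> and \<open>r2\<close> stand for $P(y|x, \tau)$
  and $P(x|y, \tau)$.
\<close>

locale guessing_game = A: prob_space A + B: prob_space B
  for A :: "'a measure" and B :: "'b measure" +
  fixes P :: "('x::finite \<times> 'y::finite) pmf"
    and c1 :: "'x \<Rightarrow> 'a \<Rightarrow> transcript \<Rightarrow> codebook" and c2 :: "'y \<Rightarrow> 'b \<Rightarrow> transcript \<Rightarrow> codebook"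
    and m1 :: "'x \<Rightarrow> 'a \<Rightarrow> transcript \<Rightarrow> message" and m2 :: "'y \<Rightarrow> 'b \<Rightarrow> transcript \<Rightarrow> message"
    and g1 :: "'x \<Rightarrow> 'a \<Rightarrow> transcript \<Rightarrow> 'f" and g2 :: "'y \<Rightarrow> 'b \<Rightarrow> transcript \<Rightarrow> 'f"
    and E :: "('f \<times> 'x \<times> 'y) set" and r1 r2 :: "'f \<Rightarrow> 'x \<Rightarrow> 'y \<Rightarrow> real" and K :: real
  assumes measurable_party [measurable]:
      "\<And>x h m. (\<lambda>a. c1 x a h m) \<in> measurable A (count_space UNIV)"
      "\<And>y h m. (\<lambda>b. c2 y b h m) \<in> measurable B (count_space UNIV)"
      "\<And>x h. (\<lambda>a. m1 x a h) \<in> measurable A (count_space UNIV)"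
      "\<And>y h. (\<lambda>b. m2 y b h) \<in> measurable B (count_space UNIV)"
      "\<And>x t. (\<lambda>a. g1 x a t) \<in> measurable A (count_space UNIV)"
      "\<And>y t. (\<lambda>b. g2 y b t) \<in> measurable B (count_space UNIV)"
    and finite_E: "finite E" and K: "0 \<le> K"
    and r1: "\<And>f x y. 0 \<le> r1 f x y" "\<And>f x. (\<Sum>y\<in>UNIV. r1 f x y) \<le> 1"
    and r2: "\<And>f x y. 0 \<le> r2 f x y" "\<And>f y. (\<Sum>x\<in>UNIV. r2 f x y) \<le> 1"
    and E: "\<And>f x y. (f, x, y) \<in> E \<Longrightarrow> (pmf P (x, y))\<^sup>2 \<le>
      K * (pmf (map_pmf fst P) x * r1 f x y) * (pmf (map_pmf snd P) y * r2 f x y)"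
begin

definition joint :: "('x \<Rightarrow> 'y \<Rightarrow> 'a \<times> 'b \<Rightarrow> bool) \<Rightarrow> real" where
  "joint Q = (\<Sum>x\<in>UNIV. \<Sum>y\<in>UNIV. pmf P (x, y) *
     measure (A \<Otimes>\<^sub>M B) {\<omega> \<in> space (A \<Otimes>\<^sub>M B). Q x y \<omega>})"

text \<open>If the inputs were drawn independently from their marginals, the parties would have
  coins in \<open>S x\<close> and \<open>T y\<close> with probability
  \<open>mass1 S * mass2 T\<close>. The bounds below compare the actual probability
  \<open>joint\<close> with the square root of this product.\<close>

definition mass1 :: "('x \<Rightarrow> 'a set) \<Rightarrow> real" where
  "mass1 S = (\<Sum>x\<in>UNIV. pmf (map_pmf fst P) x * measure A (S x))"

definition mass2 :: "('y \<Rightarrow> 'b set) \<Rightarrow> real" where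
  "mass2 T = (\<Sum>y\<in>UNIV. pmf (map_pmf snd P) y * measure B (T y))"

definition correct :: "transcript \<Rightarrow> 'x \<Rightarrow> 'y \<Rightarrow> 'a \<times> 'b \<Rightarrow> bool" where
  "correct t x y \<omega> \<longleftrightarrow> (g1 x (fst \<omega>) t, x, y) \<in> E \<and> g2 y (snd \<omega>) t = g1 x (fst \<omega>) t"

definition wins :: "nat \<Rightarrow> nat \<Rightarrow> transcript \<Rightarrow> 'x \<Rightarrow> 'y \<Rightarrow> 'a \<times> 'b \<Rightarrow> bool" where
  "wins n l h x y \<omega> \<longleftrightarrow> succeeds (c1 x (fst \<omega>)) (c2 y (snd \<omega>)) (m1 x (fst \<omega>)) (m2 y (snd \<omega>))
     (\<lambda>t. correct t x y \<omega>) n l h"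

sublocale AB: pair_prob_space A B ..

lemma mass1_nonneg: "0 \<le> mass1 S" and mass2_nonneg: "0 \<le> mass2 T"
  unfolding mass1_def mass2_def by (auto intro!: sum_nonneg)

lemma mass1_UNIV: "mass1 (\<lambda>_. space A) = 1" and mass2_UNIV: "mass2 (\<lambda>_. space B) = 1"
  unfolding mass1_def mass2_def by (simp_all add: A.prob_space B.prob_space sum_pmf_eq_1)

lemma mass1_sum_le:
  assumes "finite I" "\<And>x. disjoint_family_on (\<lambda>i. F i x) I" "\<And>i x. i \<in> I \<Longrightarrow> F i x \<in> sets A"
    "\<And>i x. i \<in> I \<Longrightarrow> F i x \<subseteq> S x" "\<And>x. S x \<in> sets A"
  shows "(\<Sum>i\<in>I. mass1 (F i)) \<le> mass1 S"
  unfolding mass1_def sum.swap[of _ _ I] sum_distrib_left[symmetric]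
  using assms by (intro sum_mono mult_left_mono A.sum_measure_le_disjoint) auto

lemma mass2_sum_le:
  assumes "finite I" "\<And>y. disjoint_family_on (\<lambda>i. F i y) I" "\<And>i y. i \<in> I \<Longrightarrow> F i y \<in> sets B"
    "\<And>i y. i \<in> I \<Longrightarrow> F i y \<subseteq> T y" "\<And>y. T y \<in> sets B"
  shows "(\<Sum>i\<in>I. mass2 (F i)) \<le> mass2 T"
  unfolding mass2_def sum.swap[of _ _ I] sum_distrib_left[symmetric]
  using assms by (intro sum_mono mult_left_mono B.sum_measure_le_disjoint) auto

text \<open>The type \<open>'f\<close> is arbitrary. Equality of the two reconstructions is
  measurable because only the finitely many first components of \<open>E\<close> have to be
  tested.\<close>

lemma pred_correct [measurable]: "Measurable.pred (A \<Otimes>\<^sub>M B) (correct t x y)"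
proof -
  have fin: "finite (fst ` E)" using finite_E by simp
  have "correct t x y \<omega> \<longleftrightarrow>
      (\<exists>f\<in>fst ` E. (f, x, y) \<in> E \<and> g1 x (fst \<omega>) t = f \<and> g2 y (snd \<omega>) t = f)" for \<omega>
    unfolding correct_def by force
  then have "correct t x y = (\<lambda>\<omega>. \<exists>f\<in>fst ` E. (f, x, y) \<in> E \<and> g1 x (fst \<omega>) t = f \<and> g2 y (snd \<omega>) t = f)"
    by (intro ext)
  also have "Measurable.pred (A \<Otimes>\<^sub>M B) \<dots>"
    by (intro pred_intros_finite(4)[OF fin]) measurable
  finally show ?thesis .
qed

lemma pred_wins [measurable]: "Measurable.pred (A \<Otimes>\<^sub>M B) (wins n l h x y)"
  unfolding wins_def by measurable

text \<open>Union bound for a finite cover, applied at each pair of inputs.\<close>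

lemma joint_le_sum:
  assumes "finite I"
    and meas: "\<And>i x y. i \<in> I \<Longrightarrow> Measurable.pred (A \<Otimes>\<^sub>M B) (Q' i x y)"
    and cover: "\<And>x y \<omega>. Q x y \<omega> \<Longrightarrow> \<exists>i\<in>I. Q' i x y \<omega>"
  shows "joint Q \<le> (\<Sum>i\<in>I. joint (Q' i))"
proof -
  have "measure (A \<Otimes>\<^sub>M B) {\<omega> \<in> space (A \<Otimes>\<^sub>M B). Q x y \<omega>} \<le>
      (\<Sum>i\<in>I. measure (A \<Otimes>\<^sub>M B) {\<omega> \<in> space (A \<Otimes>\<^sub>M B). Q' i x y \<omega>})" for x y
  proof -
    have sets: "{\<omega> \<in> space (A \<Otimes>\<^sub>M B). Q' i x y \<omega>} \<in> sets (A \<Otimes>\<^sub>M B)" if "i \<in> I" for i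
      using meas[OF that] unfolding pred_def .
    have "measure (A \<Otimes>\<^sub>M B) {\<omega> \<in> space (A \<Otimes>\<^sub>M B). Q x y \<omega>} \<le>
        measure (A \<Otimes>\<^sub>M B) (\<Union>i\<in>I. {\<omega> \<in> space (A \<Otimes>\<^sub>M B). Q' i x y \<omega>})"
      using assms(1) cover sets by (intro AB.finite_measure_mono) (blast, auto)
    also have "\<dots> \<le> (\<Sum>i\<in>I. measure (A \<Otimes>\<^sub>M B) {\<omega> \<in> space (A \<Otimes>\<^sub>M B). Q' i x y \<omega>})"
      using assms(1) sets by (intro AB.finite_measure_subadditive_finite) auto
    finally show ?thesis .
  qed
  then have "joint Q \<le> (\<Sum>x\<in>UNIV. \<Sum>y\<in>UNIV. pmf P (x, y) *
      (\<Sum>i\<in>I. measure (A \<Otimes>\<^sub>M B) {\<omega> \<in> space (A \<Otimes>\<^sub>M B). Q' i x y \<omega>}))"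
    unfolding joint_def by (intro sum_mono mult_left_mono) auto
  also have "\<dots> = (\<Sum>i\<in>I. joint (Q' i))"
    unfolding joint_def sum_distrib_left sum.swap[of _ _ I] ..
  finally show ?thesis .
qed

text \<open>At fixed inputs the two private coins are independent, so a rectangle of coins has
  product probability. Only one term of the double sum survives.\<close>

lemma joint_point:
  assumes "S \<in> sets A" "T \<in> sets B"
  shows "joint (\<lambda>x y \<omega>. x = x0 \<and> y = y0 \<and> fst \<omega> \<in> S \<and> snd \<omega> \<in> T) =
    pmf P (x0, y0) * (measure A S * measure B T)"
proof -
  have "measure (A \<Otimes>\<^sub>M B) {\<omega> \<in> space (A \<Otimes>\<^sub>M B). x = x0 \<and> y = y0 \<and> fst \<omega> \<in> S \<and> snd \<omega> \<in> T} =
      (if x = x0 \<and> y = y0 then measure A S * measure B T else 0)" for x y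
  proof (cases "x = x0 \<and> y = y0")
    case True
    have "{\<omega> \<in> space (A \<Otimes>\<^sub>M B). fst \<omega> \<in> S \<and> snd \<omega> \<in> T} = S \<times> T"
      using assms[THEN sets.sets_into_space] by (auto simp: space_pair_measure)
    moreover have "measure (A \<Otimes>\<^sub>M B) (S \<times> T) = measure A S * measure B T"
      unfolding measure_def by (simp add: B.emeasure_pair_measure_Times assms enn2real_mult)
    ultimately show ?thesis using True by simp
  qed auto
  then have "joint (\<lambda>x y \<omega>. x = x0 \<and> y = y0 \<and> fst \<omega> \<in> S \<and> snd \<omega> \<in> T) =
      (\<Sum>x\<in>UNIV. \<Sum>y\<in>UNIV. if (x, y) = (x0, y0) then pmf P (x0, y0) * (measure A S * measure B T) else 0)"
    unfolding joint_def by (intro sum.cong) auto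
  also have "\<dots> = (\<Sum>z\<in>UNIV. if z = (x0, y0) then pmf P (x0, y0) * (measure A S * measure B T) else 0)"
    unfolding sum.cartesian_product by (intro sum.cong) (auto split: if_splits)
  finally show ?thesis by simp
qed

text \<open>The bound for one transcript \<open>t\<close>. The event is covered by rectangles, one
  for each triple in \<open>E\<close>, formed from the coins \<open>SS f x\<close> and
  \<open>TT f y\<close> with which the parties reconstruct \<open>f\<close>. The assumption on
  \<open>E\<close> bounds each rectangle by a geometric mean, and Cauchy-Schwarz sums these.\<close>

lemma joint_correct_le:
  assumes S: "\<And>x. S x \<in> sets A" and T: "\<And>y. T y \<in> sets B"
  shows "joint (\<lambda>x y \<omega>. fst \<omega> \<in> S x \<and> snd \<omega> \<in> T y \<and> correct t x y \<omega>) \<le>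
    sqrt K * (sqrt (mass1 S) * sqrt (mass2 T))"
proof -
  define SS where "SS f x = {a \<in> S x. g1 x a t = f}" for f x
  define TT where "TT f y = {b \<in> T y. g2 y b t = f}" for f y
  have "SS f x = S x \<inter> {a \<in> space A. g1 x a t = f}" for f x
    using S[THEN sets.sets_into_space] by (auto simp: SS_def)
  then have SS [measurable]: "SS f x \<in> sets A" for f x using S by simp
  have "TT f y = T y \<inter> {b \<in> space B. g2 y b t = f}" for f y
    using T[THEN sets.sets_into_space] by (auto simp: TT_def)
  then have TT [measurable]: "TT f y \<in> sets B" for f y using T by simp
  define p where "p = (\<lambda>(f, x, y). (pmf (map_pmf fst P) x * r1 f x y) * measure A (SS f x))"
  define q where "q = (\<lambda>(f, x, y). (pmf (map_pmf snd P) y * r2 f x y) * measure B (TT f y))"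
  have p0: "0 \<le> p i" and q0: "0 \<le> q i" for i
    by (auto simp: p_def q_def r1 r2 split: prod.split)
  define Q where "Q = (\<lambda>(f, x0, y0) x y \<omega>. x = x0 \<and> y = y0 \<and> fst \<omega> \<in> SS f x0 \<and> snd \<omega> \<in> TT f y0)"
  have Q: "joint (Q (f, x, y)) = pmf P (x, y) * (measure A (SS f x) * measure B (TT f y))" for f x y
    unfolding Q_def by (simp add: joint_point)
  have "joint (\<lambda>x y \<omega>. fst \<omega> \<in> S x \<and> snd \<omega> \<in> T y \<and> correct t x y \<omega>) \<le> (\<Sum>i\<in>E. joint (Q i))"
  proof (rule joint_le_sum[OF finite_E])
    show "Measurable.pred (A \<Otimes>\<^sub>M B) (Q i x y)" for i x y
      by (cases i) (simp add: Q_def)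
    show "\<exists>i\<in>E. Q i x y \<omega>" if "fst \<omega> \<in> S x \<and> snd \<omega> \<in> T y \<and> correct t x y \<omega>" for x y \<omega>
      using that by (intro bexI[of _ "(g1 x (fst \<omega>) t, x, y)"]) (auto simp: Q_def SS_def TT_def correct_def)
  qed
  also have "\<dots> \<le> (\<Sum>i\<in>E. sqrt K * (sqrt (p i) * sqrt (q i)))"
  proof (rule sum_mono)
    fix i assume i: "i \<in> E"
    obtain f x y where [simp]: "i = (f, x, y)" by (cases i)
    let ?a = "measure A (SS f x)" and ?b = "measure B (TT f y)"
    have ab: "0 \<le> ?a * ?b" "?a * ?b \<le> 1" by (simp_all add: mult_le_one)
    \<comment> \<open>The square contains \<open>?a * ?b\<close> twice, whereas
      \<open>p i * q i\<close> contains it once; the surplus factor is a probability and is bounded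
      by 1.\<close>
    have "(pmf P (x, y) * (?a * ?b))\<^sup>2 = (pmf P (x, y))\<^sup>2 * ((?a * ?b) * (?a * ?b))"
      by (simp add: power2_eq_square)
    also have "\<dots> \<le> (K * (pmf (map_pmf fst P) x * r1 f x y) * (pmf (map_pmf snd P) y * r2 f x y)) *
        ((?a * ?b) * 1)"
      using ab i E[of f x y] K by (intro mult_mono) (auto simp: r1 r2)
    also have "\<dots> = K * (p i * q i)" by (simp add: p_def q_def)
    finally have "pmf P (x, y) * (?a * ?b) \<le> sqrt (K * (p i * q i))"
      by (rule real_le_rsqrt)
    then show "joint (Q i) \<le> sqrt K * (sqrt (p i) * sqrt (q i))"
      by (simp add: Q real_sqrt_mult)
  qed
  also have "\<dots> \<le> sqrt K * (sqrt (sum p E) * sqrt (sum q E))"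
    unfolding sum_distrib_left[symmetric] using K p0 q0 by (intro mult_left_mono sum_sqrt_mult_le) auto
  also have "\<dots> \<le> sqrt K * (sqrt (mass1 S) * sqrt (mass2 T))"
  proof -
    let ?F = "fst ` E"
    have F: "finite ?F" using finite_E by simp
    have sub: "E \<subseteq> ?F \<times> UNIV \<times> UNIV" by force
    have "sum p E \<le> sum p (?F \<times> UNIV \<times> UNIV)"
      using F sub p0 by (intro sum_mono2) auto
    also have "\<dots> = (\<Sum>f\<in>?F. \<Sum>x\<in>UNIV. \<Sum>y\<in>UNIV. p (f, x, y))"
      by (simp add: sum.cartesian_product)
    \<comment> \<open>Summation over \<open>y\<close> removes the weight \<open>r1\<close>. The sets
      \<open>SS f x\<close> for different \<open>f\<close> are disjoint, so their masses add up to
      at most \<open>mass1 S\<close>.\<close>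
    also have "\<dots> = (\<Sum>f\<in>?F. \<Sum>x\<in>UNIV. (pmf (map_pmf fst P) x * measure A (SS f x)) * (\<Sum>y\<in>UNIV. r1 f x y))"
      unfolding sum_distrib_left by (intro sum.cong refl) (simp add: p_def)
    also have "\<dots> \<le> (\<Sum>f\<in>?F. \<Sum>x\<in>UNIV. (pmf (map_pmf fst P) x * measure A (SS f x)) * 1)"
      by (intro sum_mono mult_left_mono r1) auto
    also have "\<dots> = (\<Sum>f\<in>?F. mass1 (SS f))" by (simp add: mass1_def)
    also have "\<dots> \<le> mass1 S"
      by (rule mass1_sum_le[OF F _ SS _ S]) (auto simp: disjoint_family_on_def SS_def)
    finally have p: "sum p E \<le> mass1 S" .
    have "sum q E \<le> sum q (?F \<times> UNIV \<times> UNIV)"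
      using F sub q0 by (intro sum_mono2) auto
    also have "\<dots> = (\<Sum>f\<in>?F. \<Sum>x\<in>UNIV. \<Sum>y\<in>UNIV. q (f, x, y))"
      by (simp add: sum.cartesian_product)
    \<comment> \<open>The weight \<open>r2\<close> sums to at most 1 over \<open>x\<close>, so here
      the sum over \<open>x\<close> has to be the inner one.\<close>
    also have "\<dots> = (\<Sum>f\<in>?F. \<Sum>y\<in>UNIV. \<Sum>x\<in>UNIV. q (f, x, y))"
      by (intro sum.cong refl sum.swap)
    also have "\<dots> = (\<Sum>f\<in>?F. \<Sum>y\<in>UNIV. (pmf (map_pmf snd P) y * measure B (TT f y)) * (\<Sum>x\<in>UNIV. r2 f x y))"
      unfolding sum_distrib_left by (intro sum.cong refl) (simp add: q_def)
    also have "\<dots> \<le> (\<Sum>f\<in>?F. \<Sum>y\<in>UNIV. (pmf (map_pmf snd P) y * measure B (TT f y)) * 1)"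
      by (intro sum_mono mult_left_mono r2) auto
    also have "\<dots> = (\<Sum>f\<in>?F. mass2 (TT f))" by (simp add: mass2_def)
    also have "\<dots> \<le> mass2 T"
      by (rule mass2_sum_le[OF F _ TT _ T]) (auto simp: disjoint_family_on_def TT_def)
    finally have q: "sum q E \<le> mass2 T" .
    show ?thesis
      using p q p0 q0 K by (intro mult_left_mono mult_mono) (auto intro!: sum_nonneg mass1_nonneg)
  qed
  finally show ?thesis .
qed

section \<open>Induction over the rounds of the game\<close>

text \<open>
  Both parties know the codebook, hence their coins are split by its value before they are split by
  the message. This is why Kraft's inequality applies although the codebooks of different executions
  may differ and the transcripts altogether need not form a prefix-free set.
\<close>

lemma joint_wins_le:
  assumes "\<And>x. S x \<in> sets A" "\<And>y. T y \<in> sets B"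
  shows "joint (\<lambda>x y \<omega>. fst \<omega> \<in> S x \<and> snd \<omega> \<in> T y \<and> wins n l h x y \<omega>) \<le>
    sqrt K * (sqrt 2 ^ l * (sqrt (mass1 S) * sqrt (mass2 T)))"
  using assms
proof (induction n arbitrary: l h S T)
  case 0
  then show ?case
    using K by (simp add: wins_def joint_def mass1_nonneg mass2_nonneg)
next
  case (Suc n)
  note S = Suc.prems(1) and T = Suc.prems(2)
  define SS where "SS v x = {a \<in> S x. \<forall>m\<in>short l. c1 x a h m = v m}" for v x
  define TT where "TT v y = {b \<in> T y. \<forall>m\<in>short l. c2 y b h m = v m}" for v y
  \<comment> \<open>The implications split only the coins of the speaker: \<open>T' v m\<close> is
    all of \<open>TT v\<close> when Party 1 speaks, \<open>S' v m\<close> is all of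
    \<open>SS v\<close> when Party 2 does.\<close>
  define S' where "S' v m x = {a \<in> SS v x. even (length h) \<longrightarrow> m1 x a h = m}" for v m x
  define T' where "T' v m y = {b \<in> TT v y. odd (length h) \<longrightarrow> m2 y b h = m}" for v m y
  have "SS v x = S x \<inter> {a \<in> space A. \<forall>m\<in>short l. c1 x a h m = v m}" for v x
    using S[THEN sets.sets_into_space] by (auto simp: SS_def)
  then have SS: "SS v x \<in> sets A" for v x using S by simp
  have "TT v y = T y \<inter> {b \<in> space B. \<forall>m\<in>short l. c2 y b h m = v m}" for v y
    using T[THEN sets.sets_into_space] by (auto simp: TT_def)
  then have TT: "TT v y \<in> sets B" for v y using T by simp
  have "S' v m x = SS v x \<inter> {a \<in> space A. even (length h) \<longrightarrow> m1 x a h = m}" for v m x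
    using SS[THEN sets.sets_into_space] by (auto simp: S'_def)
  then have S' [measurable]: "S' v m x \<in> sets A" for v m x using SS by simp
  have "T' v m y = TT v y \<inter> {b \<in> space B. odd (length h) \<longrightarrow> m2 y b h = m}" for v m y
    using TT[THEN sets.sets_into_space] by (auto simp: T'_def)
  then have T' [measurable]: "T' v m y \<in> sets B" for v m y using TT by simp
  \<comment> \<open>The index set contains only pairs with \<open>m \<in> dom v\<close>, for which a
    state other than \<open>Stop\<close> is \<open>Continue\<close>; the play then goes on with the
    bits that are left.\<close>
  define R where "R v m x y \<omega> \<longleftrightarrow> (if v m = Some Stop then correct (h @ [m]) x y \<omega>
      else wins n (l - length m) (h @ [m]) x y \<omega>)" for v :: codebook and m x y \<omega>
  define Q where "Q = (\<lambda>(v, m) x y \<omega>. fst \<omega> \<in> S' v m x \<and> snd \<omega> \<in> T' v m y \<and> R v m x y \<omega>)"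
  let ?I = "SIGMA v:codes l. dom v"
  have fin: "finite (dom v)" if "v \<in> codes l" for v
    using that by (auto simp: codes_def intro: finite_subset[OF _ finite_short])
  then have finI: "finite ?I" using finite_codes by auto
  have "joint (\<lambda>x y \<omega>. fst \<omega> \<in> S x \<and> snd \<omega> \<in> T y \<and> wins (Suc n) l h x y \<omega>) \<le> (\<Sum>i\<in>?I. joint (Q i))"
  proof (rule joint_le_sum[OF finI])
    show "Measurable.pred (A \<Otimes>\<^sub>M B) (Q i x y)" for i x y
      by (cases i) (simp add: Q_def R_def)
  next
    fix x y \<omega> assume *: "fst \<omega> \<in> S x \<and> snd \<omega> \<in> T y \<and> wins (Suc n) l h x y \<omega>"
    \<comment> \<open>The codebook of Party 1, cut to short messages so that it lies in
      \<open>codes l\<close>; on these messages it is also the codebook of Party 2.\<close>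
    define v where "v = c1 x (fst \<omega>) h |` short l"
    note win = *[unfolded wins_def succeeds.simps, folded wins_def, THEN conjunct2, THEN conjunct2]
    note eq = win[THEN conjunct1] and free = win[THEN conjunct2, THEN conjunct1]
    obtain m where m: "m \<in> short l" "(if even (length h) then m1 x (fst \<omega>) h else m2 y (snd \<omega>) h) = m"
      "c1 x (fst \<omega>) h m = Some Stop \<and> correct (h @ [m]) x y \<omega> \<or>
       c1 x (fst \<omega>) h m = Some Continue \<and> wins n (l - length m) (h @ [m]) x y \<omega>"
      using win[THEN conjunct2, THEN conjunct2] by (elim bexE conjE)
    have v: "v m' = c1 x (fst \<omega>) h m'" if "m' \<in> short l" for m'
      using that by (simp add: v_def)
    have vm: "v m = c1 x (fst \<omega>) h m" using v m(1) by blast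
    have "m \<in> dom v" using m(3) vm by (auto simp: dom_def)
    moreover have sub: "dom v \<subseteq> short l" by (auto simp: v_def)
    have "prefix_free (dom v)"
      unfolding prefix_free_def
    proof (intro ballI impI)
      fix m m' assume mm: "m \<in> dom v" "m' \<in> dom v" "prefix m m'"
      then have mS: "m \<in> short l" "m' \<in> short l" using sub by blast+
      have "c1 x (fst \<omega>) h m \<noteq> None" using v[OF mS(1)] mm(1) by (simp add: dom_def)
      moreover have "c1 x (fst \<omega>) h m' \<noteq> None" using v[OF mS(2)] mm(2) by (simp add: dom_def)
      ultimately show "m = m'" using free[rule_format, OF mS] mm(3) by argo
    qed
    then have "v \<in> codes l" using sub by (simp add: codes_def)
    moreover have "\<forall>m'\<in>short l. c1 x (fst \<omega>) h m' = v m'" by (simp add: v)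
    then have "fst \<omega> \<in> S' v m x"
      using conjunct1[OF *] m(2) by (cases "even (length h)") (simp_all add: S'_def SS_def)
    moreover have "c2 y (snd \<omega>) h m' = v m'" if "m' \<in> short l" for m'
      using eq[rule_format, OF that] v[OF that] by argo
    then have "snd \<omega> \<in> T' v m y"
      using conjunct1[OF conjunct2[OF *]] m(2) by (cases "even (length h)") (simp_all add: T'_def TT_def)
    moreover have "R v m x y \<omega>"
      using m(3) unfolding R_def vm by (elim disjE conjE) simp_all
    ultimately show "\<exists>i\<in>?I. Q i x y \<omega>"
      by (intro bexI[of _ "(v, m)"]) (auto simp: Q_def)
  qed
  also have "\<dots> = (\<Sum>v\<in>codes l. \<Sum>m\<in>dom v. joint (Q (v, m)))"
    using finite_codes fin by (simp add: sum.Sigma)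
  also have "\<dots> \<le> (\<Sum>v\<in>codes l. sqrt K * (sqrt 2 ^ l * (sqrt (mass1 (SS v)) * sqrt (mass2 (TT v)))))"
  proof (rule sum_mono)
    fix v assume v: "v \<in> codes l"
    then have free: "prefix_free (dom v)" and len: "\<And>m. m \<in> dom v \<Longrightarrow> length m \<le> l"
      by (auto simp: codes_def short_def)
    have "joint (Q (v, m)) \<le> sqrt K * (sqrt 2 ^ (l - length m) * (sqrt (mass1 (S' v m)) * sqrt (mass2 (T' v m))))"
      for m
    proof (cases "v m = Some Stop")
      case True
      have "joint (Q (v, m)) \<le> sqrt K * (1 * (sqrt (mass1 (S' v m)) * sqrt (mass2 (T' v m))))"
        using True joint_correct_le[of "S' v m" "T' v m" "h @ [m]"] S' T' by (simp add: Q_def R_def)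
      also have "\<dots> \<le> sqrt K * (sqrt 2 ^ (l - length m) * (sqrt (mass1 (S' v m)) * sqrt (mass2 (T' v m))))"
        using K by (intro mult_left_mono mult_right_mono) (auto simp: mass1_nonneg mass2_nonneg)
      finally show ?thesis .
    next
      case False
      then show ?thesis
        using Suc.IH[of "S' v m" "T' v m" "l - length m" "h @ [m]"] S' T' by (simp add: Q_def R_def)
    qed
    then have "(\<Sum>m\<in>dom v. joint (Q (v, m))) \<le> sqrt K *
        (\<Sum>m\<in>dom v. sqrt 2 ^ (l - length m) * (sqrt (mass1 (S' v m)) * sqrt (mass2 (T' v m))))"
      unfolding sum_distrib_left by (intro sum_mono)
    also have "\<dots> \<le> sqrt K * (sqrt 2 ^ l * (sqrt (mass1 (SS v)) * sqrt (mass2 (TT v))))"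
    proof (intro mult_left_mono)
      show "(\<Sum>m\<in>dom v. sqrt 2 ^ (l - length m) * (sqrt (mass1 (S' v m)) * sqrt (mass2 (T' v m))))
          \<le> sqrt 2 ^ l * (sqrt (mass1 (SS v)) * sqrt (mass2 (TT v)))"
      \<comment> \<open>Only the mass of the speaker is divided among the messages. That of the
        listener is a common factor, which leaves the sum of
        \<open>kraft_sqrt_sum_le\<close>.\<close>
      proof (cases "even (length h)")
        case True
        then have T'_eq: "T' v m = TT v" for m by (auto simp: T'_def)
        have "(\<Sum>m\<in>dom v. mass1 (S' v m)) \<le> mass1 (SS v)"
          using True by (intro mass1_sum_le[OF fin[OF v] _ S' _ SS]) (auto simp: disjoint_family_on_def S'_def)
        then have "(\<Sum>m\<in>dom v. sqrt 2 ^ (l - length m) * sqrt (mass1 (S' v m))) * sqrt (mass2 (TT v))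
            \<le> (sqrt 2 ^ l * sqrt (mass1 (SS v))) * sqrt (mass2 (TT v))"
          by (intro mult_right_mono kraft_sqrt_sum_le free len) (auto simp: mass1_nonneg mass2_nonneg)
        then show ?thesis unfolding T'_eq sum_distrib_right by (simp only: mult_ac)
      next
        case False
        then have S'_eq: "S' v m = SS v" for m by (auto simp: S'_def)
        have "(\<Sum>m\<in>dom v. mass2 (T' v m)) \<le> mass2 (TT v)"
          using False by (intro mass2_sum_le[OF fin[OF v] _ T' _ TT]) (auto simp: disjoint_family_on_def T'_def)
        then have "(\<Sum>m\<in>dom v. sqrt 2 ^ (l - length m) * sqrt (mass2 (T' v m))) * sqrt (mass1 (SS v))
            \<le> (sqrt 2 ^ l * sqrt (mass2 (TT v))) * sqrt (mass1 (SS v))"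
          by (intro mult_right_mono kraft_sqrt_sum_le free len) (auto simp: mass1_nonneg mass2_nonneg)
        then show ?thesis unfolding S'_eq sum_distrib_right by (simp only: mult_ac)
      qed
    qed (use K in auto)
    finally show "(\<Sum>m\<in>dom v. joint (Q (v, m))) \<le> sqrt K * (sqrt 2 ^ l * (sqrt (mass1 (SS v)) * sqrt (mass2 (TT v))))" .
  qed
  also have "\<dots> = sqrt K * (sqrt 2 ^ l * (\<Sum>v\<in>codes l. sqrt (mass1 (SS v)) * sqrt (mass2 (TT v))))"
    by (simp add: sum_distrib_left)
  \<comment> \<open>The codebook splits the masses of both parties at once, so summing over its
    values costs no bits.\<close>
  also have "\<dots> \<le> sqrt K * (sqrt 2 ^ l * (sqrt (\<Sum>v\<in>codes l. mass1 (SS v)) * sqrt (\<Sum>v\<in>codes l. mass2 (TT v))))"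
    using K by (intro mult_left_mono sum_sqrt_mult_le) (auto simp: mass1_nonneg mass2_nonneg)
  also have "\<dots> \<le> sqrt K * (sqrt 2 ^ l * (sqrt (mass1 S) * sqrt (mass2 T)))"
  proof -
    \<comment> \<open>Outside \<open>short l\<close> both codebooks are undefined. Different
      elements of \<open>codes l\<close> thus differ on a short message, and the sets
      \<open>SS v x\<close> are disjoint.\<close>
    have codes_eqI: "v = v'" if "v \<in> codes l" "v' \<in> codes l" "\<forall>m\<in>short l. v m = v' m" for v v'
    proof
      fix m show "v m = v' m"
      proof (cases "m \<in> short l")
        case False
        then have "v m = None" "v' m = None" using that(1,2) by (auto simp: codes_def)
        then show ?thesis by simp
      qed (use that(3) in blast)
    qed
    have "disjoint_family_on (\<lambda>v. SS v x) (codes l)" for x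
      unfolding disjoint_family_on_def
    proof (intro ballI impI, rule ccontr)
      fix v v' assume vv: "v \<in> codes l" "v' \<in> codes l" "v \<noteq> v'" and "SS v x \<inter> SS v' x \<noteq> {}"
      then obtain a where "a \<in> SS v x" "a \<in> SS v' x" by blast
      then have "v m = v' m" if "m \<in> short l" for m
        using that by (simp add: SS_def)
      with vv show False using codes_eqI by blast
    qed
    then have 1: "(\<Sum>v\<in>codes l. mass1 (SS v)) \<le> mass1 S"
      by (intro mass1_sum_le[OF finite_codes _ SS _ S]) (auto simp: SS_def)
    have "disjoint_family_on (\<lambda>v. TT v y) (codes l)" for y
      unfolding disjoint_family_on_def
    proof (intro ballI impI, rule ccontr)
      fix v v' assume vv: "v \<in> codes l" "v' \<in> codes l" "v \<noteq> v'" and "TT v y \<inter> TT v' y \<noteq> {}"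
      then obtain b where "b \<in> TT v y" "b \<in> TT v' y" by blast
      then have "v m = v' m" if "m \<in> short l" for m
        using that by (simp add: TT_def)
      with vv show False using codes_eqI by blast
    qed
    then have 2: "(\<Sum>v\<in>codes l. mass2 (TT v)) \<le> mass2 T"
      by (intro mass2_sum_le[OF finite_codes _ TT _ T]) (auto simp: TT_def)
    show ?thesis
      using 1 2 K by (intro mult_left_mono mult_mono) (auto intro!: sum_nonneg mass1_nonneg mass2_nonneg)
  qed
  finally show ?case .
qed

end

section \<open>Measurability on the space of executions\<close>

lemma inX_eq: "inX \<omega> = fst (fst \<omega>)" and inY_eq: "inY \<omega> = snd (fst \<omega>)"
  and coinU_eq: "coinU \<omega> = fst (snd \<omega>)" and coin1_eq: "coin1 \<omega> = fst (snd (snd \<omega>))"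
  and coin2_eq: "coin2 \<omega> = snd (snd (snd \<omega>))"
  by (cases \<omega> rule: inX.cases; simp)+

lemma measurable_exec_space [measurable]:
  "inX \<in> measurable (exec_space P p) (count_space UNIV)"
  "inY \<in> measurable (exec_space P p) (count_space UNIV)"
  "coinU \<in> measurable (exec_space P p) (pub p)"
  "coin1 \<in> measurable (exec_space P p) (priv1 p)"
  "coin2 \<in> measurable (exec_space P p) (priv2 p)"
proof -
  have 1: "fst \<in> measurable (exec_space P p) (measure_pmf P)" unfolding exec_space_def by measurable
  have "fst \<in> measurable (measure_pmf P) (count_space UNIV)" "snd \<in> measurable (measure_pmf P) (count_space UNIV)"
    by simp_all
  from this[THEN measurable_compose[OF 1]]
  show "inX \<in> measurable (exec_space P p) (count_space UNIV)"
    "inY \<in> measurable (exec_space P p) (count_space UNIV)"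
    by (simp_all add: inX_eq[abs_def] inY_eq[abs_def])
  show "coinU \<in> measurable (exec_space P p) (pub p)"
    "coin1 \<in> measurable (exec_space P p) (priv1 p)" "coin2 \<in> measurable (exec_space P p) (priv2 p)"
    unfolding exec_space_def coinU_eq[abs_def] coin1_eq[abs_def] coin2_eq[abs_def] by measurable
qed

text \<open>The input takes finitely many values, so it may be fixed; what remains is a function of
  the two coins.\<close>

lemma measurable_party1:
  fixes f :: "'x::finite \<Rightarrow> 'a \<Rightarrow> 'u \<Rightarrow> 'z"
  assumes "\<And>x. (\<lambda>(a, u). f x a u) \<in> measurable (priv1 p \<Otimes>\<^sub>M pub p) N"
  shows "(\<lambda>\<omega>. f (inX \<omega>) (coin1 \<omega>) (coinU \<omega>)) \<in> measurable (exec_space P p) N"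
proof (rule measurable_compose_countable[where g = inX])
  fix x
  have "(\<lambda>\<omega>. (coin1 \<omega>, coinU \<omega>)) \<in> measurable (exec_space P p) (priv1 p \<Otimes>\<^sub>M pub p)" by measurable
  from measurable_compose[OF this assms[of x]]
  show "(\<lambda>\<omega>. f x (coin1 \<omega>) (coinU \<omega>)) \<in> measurable (exec_space P p) N" by simp
qed measurable

lemma measurable_party2:
  fixes f :: "'y::finite \<Rightarrow> 'b \<Rightarrow> 'u \<Rightarrow> 'z"
  assumes "\<And>y. (\<lambda>(b, u). f y b u) \<in> measurable (priv2 p \<Otimes>\<^sub>M pub p) N"
  shows "(\<lambda>\<omega>. f (inY \<omega>) (coin2 \<omega>) (coinU \<omega>)) \<in> measurable (exec_space P p) N"
proof (rule measurable_compose_countable[where g = inY])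
  fix y
  have "(\<lambda>\<omega>. (coin2 \<omega>, coinU \<omega>)) \<in> measurable (exec_space P p) (priv2 p \<Otimes>\<^sub>M pub p)" by measurable
  from measurable_compose[OF this assms[of y]]
  show "(\<lambda>\<omega>. f y (coin2 \<omega>) (coinU \<omega>)) \<in> measurable (exec_space P p) N" by simp
qed measurable

section \<open>From an actual execution to the recursive notion of success\<close>

lemma length_concat_history_mono:
  "k \<le> n \<Longrightarrow> length (concat (history p \<omega> k)) \<le> length (concat (history p \<omega> n))"
  by (rule lift_Suc_mono_le[where f = "\<lambda>n. length (concat (history p \<omega> n))"]) simp_all

text \<open>Downward induction from the stopping round \<open>N\<close> to the first. Before round
  \<open>k + 1\<close> there remain \<open>Suc N - k\<close> rounds and the bits not spent in
  \<open>history p \<omega> k\<close>; the conditions on the codebooks hold there because the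
  execution is still running.\<close>

lemma succeeds_transcript:
  assumes stop: "\<exists>n. stops p \<omega> n"
    and run: "\<And>n. running p \<omega> n \<Longrightarrow> view1 p \<omega> (history p \<omega> n) = view2 p \<omega> (history p \<omega> n) \<and>
        message p \<omega> (history p \<omega> n) \<in> dom (view1 p \<omega> (history p \<omega> n))"
    and free: "\<And>n. running p \<omega> n \<Longrightarrow> prefix_free (dom (view1 p \<omega> (history p \<omega> n)))"
    and len: "length (concat (transcript_of p \<omega>)) \<le> L"
    and G: "G (transcript_of p \<omega>)"
  shows "\<exists>n. succeeds (view1 p \<omega>) (view2 p \<omega>) (msg1 p (inX \<omega>) (coin1 \<omega>) (coinU \<omega>))
    (msg2 p (inY \<omega>) (coin2 \<omega>) (coinU \<omega>)) G n L []"
proof -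
  define N where "N = (LEAST n. stops p \<omega> n)"
  have tr: "transcript_of p \<omega> = history p \<omega> (Suc N)" by (simp add: transcript_of_def N_def)
  have stopN: "stops p \<omega> N" unfolding N_def by (rule LeastI_ex[OF stop])
  have not_stop: "\<not> stops p \<omega> k" if "k < N" for k using not_less_Least that unfolding N_def by blast
  have running: "running p \<omega> k" if "k \<le> N" for k using not_stop that by (simp add: running_def)
  let ?s = "\<lambda>k. succeeds (view1 p \<omega>) (view2 p \<omega>) (msg1 p (inX \<omega>) (coin1 \<omega>) (coinU \<omega>))
    (msg2 p (inY \<omega>) (coin2 \<omega>) (coinU \<omega>)) G (Suc N - k) (L - length (concat (history p \<omega> k))) (history p \<omega> k)"
  have step: "?s k" if k: "k \<le> N" and next_round: "k < N \<Longrightarrow> ?s (Suc k)" for k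
  proof -
    define h where "h = history p \<omega> k"
    define m where "m = message p \<omega> h"
    have Suc_k: "history p \<omega> (Suc k) = h @ [m]" by (simp add: h_def m_def)
    \<comment> \<open>The history after this message is an initial part of the transcript, so the
      message fits into the remaining budget.\<close>
    have "length (concat (h @ [m])) \<le> L"
      using length_concat_history_mono[of "Suc k" "Suc N" p \<omega>] k len unfolding tr Suc_k by simp
    then have short: "m \<in> short (L - length (concat h))" by (simp add: short_def)
    have eq: "view1 p \<omega> h = view2 p \<omega> h" and dom: "m \<in> dom (view1 p \<omega> h)"
      using run[OF running[OF k]] unfolding h_def m_def by blast+
    have free_h: "view1 p \<omega> h m1 = None \<or> view1 p \<omega> h m2 = None"
      if "prefix m1 m2 \<and> m1 \<noteq> m2" for m1 m2
      using free[OF running[OF k]] that unfolding prefix_free_def h_def by blast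
    have sent: "(if even (length h) then msg1 p (inX \<omega>) (coin1 \<omega>) (coinU \<omega>) h
        else msg2 p (inY \<omega>) (coin2 \<omega>) (coinU \<omega>) h) = m"
      by (simp add: m_def message_def)
    have state: "view1 p \<omega> h m = Some Stop \<and> G (h @ [m]) \<or> view1 p \<omega> h m = Some Continue \<and>
        succeeds (view1 p \<omega>) (view2 p \<omega>) (msg1 p (inX \<omega>) (coin1 \<omega>) (coinU \<omega>))
          (msg2 p (inY \<omega>) (coin2 \<omega>) (coinU \<omega>)) G (N - k) (L - length (concat h) - length m) (h @ [m])"
    proof (cases "k = N")
      case True
      then have "view1 p \<omega> h m = Some Stop" using stopN by (simp add: stops_def h_def m_def)
      moreover have "G (h @ [m])" using G unfolding tr True[symmetric] Suc_k .
      ultimately show ?thesis by simp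
    next
      case False
      then have "view1 p \<omega> h m \<noteq> Some Stop"
        using not_stop[of k] k by (simp add: stops_def h_def m_def)
      moreover obtain st where "view1 p \<omega> h m = Some st" using dom by blast
      ultimately have "view1 p \<omega> h m = Some Continue" by (cases st) simp_all
      moreover have "?s (Suc k)" by (rule next_round) (use False k in simp)
      moreover have "L - length (concat (h @ [m])) = L - length (concat h) - length m" by simp
      ultimately show ?thesis unfolding Suc_k diff_Suc_Suc by argo
    qed
    show ?thesis
      unfolding h_def[symmetric] Suc_diff_le[OF k] succeeds.simps
    proof (intro conjI ballI impI)
      show "\<exists>m\<in>short (L - length (concat h)). (if even (length h) then msg1 p (inX \<omega>) (coin1 \<omega>) (coinU \<omega>) h
          else msg2 p (inY \<omega>) (coin2 \<omega>) (coinU \<omega>) h) = m \<and>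
        (view1 p \<omega> h m = Some Stop \<and> G (h @ [m]) \<or> view1 p \<omega> h m = Some Continue \<and>
        succeeds (view1 p \<omega>) (view2 p \<omega>) (msg1 p (inX \<omega>) (coin1 \<omega>) (coinU \<omega>))
          (msg2 p (inY \<omega>) (coin2 \<omega>) (coinU \<omega>)) G (N - k) (L - length (concat h) - length m) (h @ [m]))"
        using short sent state by (intro bexI[of _ m] conjI)
    qed (use eq free_h in auto)
  qed
  have "?s 0"
  proof (rule inc_induct[of 0 N])
    show "?s N" by (rule step) auto
    show "?s k" if "k < N" "?s (Suc k)" for k by (rule step) (use that in auto)
  qed simp
  then show ?thesis unfolding history.simps(1) concat.simps(1) list.size(3) diff_zero by (rule exI)
qed

section \<open>The probability space of a protocol\<close>

locale protocol_execution =
  fixes P :: "('x::finite \<times> 'y::finite) pmf" and p :: "('x, 'y, 'u, 'a, 'b) protocol"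
  assumes protocol: "interactive_protocol P p"
begin

abbreviation M :: "('x, 'y, 'u, 'a, 'b) outcome measure" where "M \<equiv> exec_space P p"

lemma prob_space_coins: "prob_space (pub p)" "prob_space (priv1 p)" "prob_space (priv2 p)"
  using protocol by (simp_all add: interactive_protocol_def)

lemma prob_space_exec: "prob_space M"
  unfolding exec_space_def by (intro prob_space_pair prob_space_coins prob_space_measure_pmf)

lemma measurable_msg1 [measurable]: "(\<lambda>\<omega>. msg1 p (inX \<omega>) (coin1 \<omega>) (coinU \<omega>) h) \<in> measurable M (count_space UNIV)"
  using protocol by (intro measurable_party1) (simp add: interactive_protocol_def)

lemma measurable_msg2 [measurable]: "(\<lambda>\<omega>. msg2 p (inY \<omega>) (coin2 \<omega>) (coinU \<omega>) h) \<in> measurable M (count_space UNIV)"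
  using protocol by (intro measurable_party2) (simp add: interactive_protocol_def)

lemma measurable_view1 [measurable]: "(\<lambda>\<omega>. view1 p \<omega> h m) \<in> measurable M (count_space UNIV)"
  unfolding view1_def using protocol by (intro measurable_party1) (simp add: interactive_protocol_def)

lemma measurable_view2 [measurable]: "(\<lambda>\<omega>. view2 p \<omega> h m) \<in> measurable M (count_space UNIV)"
  unfolding view2_def using protocol by (intro measurable_party2) (simp add: interactive_protocol_def)

lemma measurable_message: "(\<lambda>\<omega>. message p \<omega> h) \<in> measurable M (count_space UNIV)"
  unfolding message_def by (cases "even (length h)") simp_all

lemma measurable_history [measurable]: "(\<lambda>\<omega>. history p \<omega> n) \<in> measurable M (count_space UNIV)"
proof (induction n)
  case (Suc n)
  have "(\<lambda>\<omega>. h @ [message p \<omega> h]) \<in> measurable M (count_space UNIV)" for h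
    using measurable_message by (rule measurable_compose) simp
  from measurable_compose_countable[OF this Suc] show ?case by simp
qed simp

text \<open>History and next message have countable types, so a family of measurable predicates may
  be evaluated at them.\<close>

lemma pred_stops [measurable]: "Measurable.pred M (\<lambda>\<omega>. stops p \<omega> n)"
proof -
  have "Measurable.pred M (\<lambda>\<omega>. view1 p \<omega> h m = Some Stop)" for h m by measurable
  from measurable_compose_countable[OF this measurable_message]
  have "Measurable.pred M (\<lambda>\<omega>. view1 p \<omega> h (message p \<omega> h) = Some Stop)" for h .
  from measurable_compose_countable[OF this measurable_history]
  show ?thesis unfolding stops_def .
qed

lemma measurable_transcript_of [measurable]: "transcript_of p \<in> measurable M (count_space UNIV)"
proof -
  have "(\<lambda>\<omega>. LEAST n. stops p \<omega> n) \<in> measurable M (count_space UNIV)" by measurable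
  from measurable_compose_countable[OF measurable_history this, of Suc]
  show ?thesis unfolding transcript_of_def[abs_def] by simp
qed

section \<open>From fixed to random public coins\<close>

text \<open>The public coin is independent of the inputs and of the private coins. By Fubini the
  probability of \<open>Q\<close> is the average over \<open>u\<close> of the sums in
  \<open>le\<close>, so shared randomness cannot beat a bound that holds for each of its
  values.\<close>

lemma prob_le_of_section_le:
  assumes [measurable]: "Measurable.pred M Q"
    and le: "\<And>u. u \<in> space (pub p) \<Longrightarrow> (\<Sum>x\<in>UNIV. \<Sum>y\<in>UNIV. pmf P (x, y) *
      measure (priv1 p \<Otimes>\<^sub>M priv2 p) {\<omega> \<in> space (priv1 p \<Otimes>\<^sub>M priv2 p). Q ((x, y), u, \<omega>)}) \<le> C"
    and C: "0 \<le> C"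
  shows "measure M {\<omega> \<in> space M. Q \<omega>} \<le> C"
proof -
  let ?AB = "priv1 p \<Otimes>\<^sub>M priv2 p"
  interpret M: prob_space M by (rule prob_space_exec)
  interpret U: prob_space "pub p" by (rule prob_space_coins)
  interpret AB: prob_space ?AB by (intro prob_space_pair prob_space_coins)
  interpret UAB: prob_space "pub p \<Otimes>\<^sub>M ?AB" by (intro prob_space_pair prob_space_coins)
  let ?E = "{\<omega> \<in> space M. Q \<omega>}"
  have E: "?E \<in> sets (measure_pmf P \<Otimes>\<^sub>M (pub p \<Otimes>\<^sub>M ?AB))"
    using assms(1) unfolding pred_def exec_space_def .
  have E1: "Pair z -` ?E \<in> sets (pub p \<Otimes>\<^sub>M ?AB)" for z using sets_Pair1[OF E] .
  have slice: "Pair u -` Pair z -` ?E = {\<omega> \<in> space ?AB. Q (z, u, \<omega>)}" if "u \<in> space (pub p)" for u z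
    using that by (auto simp: exec_space_def space_pair_measure)
  have "emeasure M ?E = (\<integral>\<^sup>+z. emeasure (pub p \<Otimes>\<^sub>M ?AB) (Pair z -` ?E) \<partial>measure_pmf P)"
    unfolding exec_space_def by (rule UAB.emeasure_pair_measure_alt) (use E in \<open>simp add: exec_space_def\<close>)
  also have "\<dots> = (\<Sum>z\<in>UNIV. ennreal (pmf P z) * emeasure (pub p \<Otimes>\<^sub>M ?AB) (Pair z -` ?E))"
    by (simp add: nn_integral_measure_pmf nn_integral_count_space_finite)
  also have "\<dots> = (\<Sum>z\<in>UNIV. ennreal (pmf P z) * (\<integral>\<^sup>+u. emeasure ?AB (Pair u -` Pair z -` ?E) \<partial>pub p))"
    by (intro sum.cong refl arg_cong2[where f = "(*)"] AB.emeasure_pair_measure_alt E1)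
  \<comment> \<open>The bound concerns the sum over all inputs, which therefore has to stand inside
    the integral.\<close>
  also have "\<dots> = (\<integral>\<^sup>+u. (\<Sum>z\<in>UNIV. ennreal (pmf P z) * emeasure ?AB (Pair u -` Pair z -` ?E)) \<partial>pub p)"
    using AB.measurable_emeasure_Pair[OF E1]
    by (simp add: nn_integral_sum nn_integral_cmult del: vimage_Collect_eq)
  also have "\<dots> \<le> (\<integral>\<^sup>+u. ennreal C \<partial>pub p)"
  proof (rule nn_integral_mono)
    fix u assume u: "u \<in> space (pub p)"
    have "(\<Sum>z\<in>UNIV. ennreal (pmf P z) * emeasure ?AB (Pair u -` Pair z -` ?E)) =
        (\<Sum>z\<in>UNIV. ennreal (pmf P z * measure ?AB {\<omega> \<in> space ?AB. Q (z, u, \<omega>)}))"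
      by (simp add: slice[OF u] AB.emeasure_eq_measure ennreal_mult del: vimage_Collect_eq)
    also have "\<dots> = ennreal (\<Sum>z\<in>UNIV. pmf P z * measure ?AB {\<omega> \<in> space ?AB. Q (z, u, \<omega>)})"
      by simp
    also have "\<dots> \<le> ennreal C"
      using le[OF u] unfolding sum.cartesian_product by (intro ennreal_leI) (simp add: case_prod_beta')
    finally show "(\<Sum>z\<in>UNIV. ennreal (pmf P z) * emeasure ?AB (Pair u -` Pair z -` ?E)) \<le> ennreal C" .
  qed
  also have "\<dots> = ennreal C" by (simp add: U.emeasure_space_1)
  finally show ?thesis using C by (simp add: M.emeasure_eq_measure)
qed


lemma prob_recover_le:
  fixes F1 F2 :: "('x, 'y, 'u, 'a, 'b) outcome \<Rightarrow> 'f"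
  assumes free: "self_delimiting P p"
    and len: "AE \<omega> in M. length (concat (transcript_of p \<omega>)) \<le> L"
    and F1: "recoverable1 P p F1" and F2: "recoverable2 P p F2"
    and E: "finite E" "\<And>f x y. (f, x, y) \<in> E \<Longrightarrow> (pmf P (x, y))\<^sup>2 \<le>
      K * (pmf (map_pmf fst P) x * r1 f x y) * (pmf (map_pmf snd P) y * r2 f x y)"
    and K: "0 \<le> K"
    and r1: "\<And>f x y. 0 \<le> r1 f x y" "\<And>f x. (\<Sum>y\<in>UNIV. r1 f x y) \<le> 1"
    and r2: "\<And>f x y. 0 \<le> r2 f x y" "\<And>f y. (\<Sum>x\<in>UNIV. r2 f x y) \<le> 1"
  shows "measure M {\<omega> \<in> space M. (F1 \<omega>, inX \<omega>, inY \<omega>) \<in> E \<and> F2 \<omega> = F1 \<omega>} \<le> sqrt K * sqrt 2 ^ L"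
proof -
  interpret M: prob_space M by (rule prob_space_exec)
  obtain g1 where g1: "\<And>x t. (\<lambda>(a, u). g1 x u a t) \<in> measurable (priv1 p \<Otimes>\<^sub>M pub p) (count_space UNIV)"
    "AE \<omega> in M. F1 \<omega> = g1 (inX \<omega>) (coinU \<omega>) (coin1 \<omega>) (transcript_of p \<omega>)"
    using F1 unfolding recoverable1_def by blast
  obtain g2 where g2: "\<And>y t. (\<lambda>(b, u). g2 y u b t) \<in> measurable (priv2 p \<Otimes>\<^sub>M pub p) (count_space UNIV)"
    "AE \<omega> in M. F2 \<omega> = g2 (inY \<omega>) (coinU \<omega>) (coin2 \<omega>) (transcript_of p \<omega>)"
    using F2 unfolding recoverable2_def by blast
  have [measurable]: "(\<lambda>\<omega>. g1 (inX \<omega>) (coinU \<omega>) (coin1 \<omega>) t) \<in> measurable M (count_space UNIV)" for t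
    using g1(1) by (intro measurable_party1[where f = "\<lambda>x a u. g1 x u a t"])
  have [measurable]: "(\<lambda>\<omega>. g2 (inY \<omega>) (coinU \<omega>) (coin2 \<omega>) t) \<in> measurable M (count_space UNIV)" for t
    using g2(1) by (intro measurable_party2[where f = "\<lambda>y b u. g2 y u b t"])
  define G where "G \<omega> t \<longleftrightarrow> (g1 (inX \<omega>) (coinU \<omega>) (coin1 \<omega>) t, inX \<omega>, inY \<omega>) \<in> E \<and>
    g2 (inY \<omega>) (coinU \<omega>) (coin2 \<omega>) t = g1 (inX \<omega>) (coinU \<omega>) (coin1 \<omega>) t" for \<omega> t
  have "G \<omega> t \<longleftrightarrow> (\<exists>e\<in>E. g1 (inX \<omega>) (coinU \<omega>) (coin1 \<omega>) t = fst e \<and>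
      g2 (inY \<omega>) (coinU \<omega>) (coin2 \<omega>) t = fst e \<and> inX \<omega> = fst (snd e) \<and> inY \<omega> = snd (snd e))" for \<omega> t
    unfolding G_def by force
  then have G_eq: "(\<lambda>\<omega>. G \<omega> t) = (\<lambda>\<omega>. \<exists>e\<in>E. g1 (inX \<omega>) (coinU \<omega>) (coin1 \<omega>) t = fst e \<and>
      g2 (inY \<omega>) (coinU \<omega>) (coin2 \<omega>) t = fst e \<and> inX \<omega> = fst (snd e) \<and> inY \<omega> = snd (snd e))" for t
    by (intro ext)
  have G_meas [measurable]: "Measurable.pred M (\<lambda>\<omega>. G \<omega> t)" for t
    unfolding G_eq by (intro pred_intros_finite(4)[OF E(1)]) measurable
  define W where "W n \<omega> \<longleftrightarrow> succeeds (view1 p \<omega>) (view2 p \<omega>) (msg1 p (inX \<omega>) (coin1 \<omega>) (coinU \<omega>))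
    (msg2 p (inY \<omega>) (coin2 \<omega>) (coinU \<omega>)) (G \<omega>) n L []" for n \<omega>
  have W_meas [measurable]: "Measurable.pred M (W n)" for n
    unfolding W_def[abs_def] by (rule pred_succeeds) measurable
  have W_le: "measure M {\<omega> \<in> space M. W n \<omega>} \<le> sqrt K * sqrt 2 ^ L" for n
  proof (rule prob_le_of_section_le[OF W_meas])
    fix u assume u: "u \<in> space (pub p)"
    have slice1: "(\<lambda>a. f a u) \<in> measurable (priv1 p) N"
      if "(\<lambda>(a, u). f a u) \<in> measurable (priv1 p \<Otimes>\<^sub>M pub p) N" for f :: "'a \<Rightarrow> 'u \<Rightarrow> 'c" and N
      using measurable_compose[OF measurable_Pair2'[OF u] that] by simp
    have slice2: "(\<lambda>b. f b u) \<in> measurable (priv2 p) N"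
      if "(\<lambda>(b, u). f b u) \<in> measurable (priv2 p \<Otimes>\<^sub>M pub p) N" for f :: "'b \<Rightarrow> 'u \<Rightarrow> 'c" and N
      using measurable_compose[OF measurable_Pair2'[OF u] that] by simp
    interpret A: prob_space "priv1 p" by (rule prob_space_coins)
    interpret B: prob_space "priv2 p" by (rule prob_space_coins)
    interpret guessing_game "priv1 p" "priv2 p" P "\<lambda>x a. code1 p x a u" "\<lambda>y b. code2 p y b u"
      "\<lambda>x a. msg1 p x a u" "\<lambda>y b. msg2 p y b u" "\<lambda>x a. g1 x u a" "\<lambda>y b. g2 y u b" E r1 r2 K
    proof
      show "(\<lambda>a. code1 p x a u h m) \<in> measurable (priv1 p) (count_space UNIV)" for x h m
        using protocol by (intro slice1) (simp add: interactive_protocol_def)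
      show "(\<lambda>b. code2 p y b u h m) \<in> measurable (priv2 p) (count_space UNIV)" for y h m
        using protocol by (intro slice2) (simp add: interactive_protocol_def)
      show "(\<lambda>a. msg1 p x a u h) \<in> measurable (priv1 p) (count_space UNIV)" for x h
        using protocol by (intro slice1) (simp add: interactive_protocol_def)
      show "(\<lambda>b. msg2 p y b u h) \<in> measurable (priv2 p) (count_space UNIV)" for y h
        using protocol by (intro slice2) (simp add: interactive_protocol_def)
      show "(\<lambda>a. g1 x u a t) \<in> measurable (priv1 p) (count_space UNIV)" for x t
        by (rule slice1) (rule g1(1))
      show "(\<lambda>b. g2 y u b t) \<in> measurable (priv2 p) (count_space UNIV)" for y t
        by (rule slice2) (rule g2(1))
    qed (fact E K r1 r2)+
    have "W n ((x, y), u, \<omega>) = wins n L [] x y \<omega>" for x y \<omega>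
      unfolding W_def wins_def G_def correct_def view1_def view2_def inX_eq inY_eq coinU_eq coin1_eq coin2_eq
      by simp
    then have "(\<Sum>x\<in>UNIV. \<Sum>y\<in>UNIV. pmf P (x, y) * measure (priv1 p \<Otimes>\<^sub>M priv2 p)
        {\<omega> \<in> space (priv1 p \<Otimes>\<^sub>M priv2 p). W n ((x, y), u, \<omega>)}) =
      joint (\<lambda>x y \<omega>. fst \<omega> \<in> space (priv1 p) \<and> snd \<omega> \<in> space (priv2 p) \<and> wins n L [] x y \<omega>)"
      unfolding joint_def
      by (intro sum.cong refl arg_cong2[where f = "(*)"] arg_cong[where f = "measure _"])
        (auto simp: space_pair_measure)
    also have "\<dots> \<le> sqrt K * (sqrt 2 ^ L * (sqrt (mass1 (\<lambda>_. space (priv1 p))) * sqrt (mass2 (\<lambda>_. space (priv2 p)))))"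
      by (rule joint_wins_le) auto
    finally show "(\<Sum>x\<in>UNIV. \<Sum>y\<in>UNIV. pmf P (x, y) * measure (priv1 p \<Otimes>\<^sub>M priv2 p)
        {\<omega> \<in> space (priv1 p \<Otimes>\<^sub>M priv2 p). W n ((x, y), u, \<omega>)}) \<le> sqrt K * sqrt 2 ^ L"
      by (simp add: mass1_UNIV mass2_UNIV)
  qed (use K in simp)
  have W_ev: "AE \<omega> in M. (F1 \<omega>, inX \<omega>, inY \<omega>) \<in> E \<and> F2 \<omega> = F1 \<omega> \<longrightarrow> (\<exists>n. W n \<omega>)"
  proof -
    have "AE \<omega> in M. \<exists>n. stops p \<omega> n"
      and "AE \<omega> in M. \<forall>n. running p \<omega> n \<longrightarrow> view1 p \<omega> (history p \<omega> n) = view2 p \<omega> (history p \<omega> n) \<and>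
        message p \<omega> (history p \<omega> n) \<in> dom (view1 p \<omega> (history p \<omega> n))"
      using protocol by (simp_all add: interactive_protocol_def)
    moreover note free[unfolded self_delimiting_def] len g1(2) g2(2)
    ultimately show ?thesis
    proof eventually_elim
      case (elim \<omega>)
      show ?case
      proof
        assume "(F1 \<omega>, inX \<omega>, inY \<omega>) \<in> E \<and> F2 \<omega> = F1 \<omega>"
        then have "G \<omega> (transcript_of p \<omega>)" using elim(5,6) by (simp add: G_def)
        with elim(1-4) show "\<exists>n. W n \<omega>"
          unfolding W_def by (intro succeeds_transcript) blast+
      qed
    qed
  qed
  have "measure M {\<omega> \<in> space M. (F1 \<omega>, inX \<omega>, inY \<omega>) \<in> E \<and> F2 \<omega> = F1 \<omega>} \<le>
      measure M {\<omega> \<in> space M. \<exists>n. W n \<omega>}"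
    using W_ev by (intro M.finite_measure_mono_AE) (auto elim: eventually_mono)
  also have "\<dots> = measure M (\<Union>n. {\<omega> \<in> space M. W n \<omega>})"
    by (rule arg_cong[where f = "measure M"]) auto
  \<comment> \<open>A bound on the bits does not bound the number of rounds, as empty messages may
    be sent. The estimate therefore passes to the limit along the increasing events
    \<open>W n\<close>.\<close>
  also have "\<dots> \<le> sqrt K * sqrt 2 ^ L"
  proof (rule LIMSEQ_le_const2)
    show "(\<lambda>n. measure M {\<omega> \<in> space M. W n \<omega>}) \<longlonglongrightarrow> measure M (\<Union>n. {\<omega> \<in> space M. W n \<omega>})"
    proof (rule M.finite_Lim_measure_incseq)
      show "range (\<lambda>n. {\<omega> \<in> space M. W n \<omega>}) \<subseteq> sets M" by auto
      show "incseq (\<lambda>n. {\<omega> \<in> space M. W n \<omega>})"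
        by (rule incseq_SucI) (use succeeds_Suc in \<open>auto simp: W_def simp del: succeeds.simps\<close>)
    qed
  qed (use W_le in blast)
  finally show ?thesis .
qed

end

section \<open>Discrete distributions and their variational distance\<close>

text \<open>On a countable type with all sets measurable a probability measure is a
  \<open>pmf\<close>, whose masses sum to 1.\<close>

lemma prob_space_singletons_has_sum:
  fixes N :: "'z::countable measure"
  assumes N: "prob_space N" "sets N = UNIV"
  shows "((\<lambda>z. measure N {z}) has_sum 1) UNIV"
proof -
  interpret prob_space N by fact
  have "AE z in N. measure N {z} \<noteq> 0"
    by (subst AE_support_countable[OF N(2)]) (auto intro!: exI[of _ UNIV])
  then obtain q where q: "measure_pmf q = N"
    using Abs_pmf_inverse[of N] N by blast
  have pmf_q: "pmf q = (\<lambda>z. measure N {z})"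
    by (simp add: fun_eq_iff pmf.rep_eq q)
  have "infsum (pmf q) UNIV = 1"
    by (metis infsetsum_infsum infsetsum_pmf_eq_1 pmf_abs_summable subset_UNIV)
  moreover have "pmf q summable_on UNIV"
    using abs_summable_equivalent pmf_abs_summable abs_summable_summable by blast
  ultimately show ?thesis unfolding pmf_q[symmetric] by (simp add: has_sum_infsum[of "pmf q"] summable_iff_has_sum_infsum)
qed

text \<open>The differences of the point masses sum to 0, so the part on \<open>Z\<close> is the
  negative of the part on the complement. Hence twice the difference on \<open>Z\<close> is at most
  the sum of all absolute values.\<close>

lemma measure_diff_le_d_var:
  fixes N N' :: "'z::countable measure"
  assumes N: "prob_space N" "sets N = UNIV" and N': "prob_space N'" "sets N' = UNIV" and Z: "finite Z"
  shows "measure N Z - measure N' Z \<le> d_var N N'"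
proof -
  interpret N: prob_space N by fact
  interpret N': prob_space N' by fact
  define d where "d z = measure N {z} - measure N' {z}" for z
  have d: "(d has_sum 0) UNIV"
    using has_sum_add[OF prob_space_singletons_has_sum[OF N] has_sum_uminusI[OF prob_space_singletons_has_sum[OF N']]]
    by (simp add: d_def[abs_def])
  then have summable: "d summable_on A" for A
    using summable_on_subset_banach[of d UNIV A] by (auto simp: summable_on_def)
  then have abs: "(\<lambda>z. \<bar>d z\<bar>) summable_on A" for A
    using summable_on_iff_abs_summable_on_real[of d A] by simp
  have "0 = infsum d (Z \<union> - Z)" using infsumI[OF d] by (simp add: Compl_partition)
  also have "\<dots> = infsum d Z + infsum d (- Z)"
    by (rule infsum_Un_disjoint[OF summable summable]) simp
  finally have "2 * sum d Z = infsum d Z + - infsum d (- Z)" using Z by simp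
  also have "\<dots> = infsum d Z + infsum (\<lambda>z. - d z) (- Z)" by (simp add: infsum_uminus)
  also have "\<dots> \<le> infsum (\<lambda>z. \<bar>d z\<bar>) Z + infsum (\<lambda>z. \<bar>d z\<bar>) (- Z)"
    by (intro add_mono infsum_mono abs summable) (auto simp: summable_on_uminus summable)
  also have "\<dots> = infsum (\<lambda>z. \<bar>d z\<bar>) (Z \<union> - Z)"
    by (rule infsum_Un_disjoint[OF abs abs, symmetric]) simp
  also have "\<dots> = 2 * d_var N N'" by (simp add: d_var_def d_def Compl_partition)
  finally have "sum d Z \<le> d_var N N'" by simp
  moreover have "measure N Z = (\<Sum>z\<in>Z. measure N {z})" "measure N' Z = (\<Sum>z\<in>Z. measure N' {z})"
    using Z N(2) N'(2) by (auto intro: N.finite_measure_eq_sum_singleton N'.finite_measure_eq_sum_singleton)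
  ultimately show ?thesis by (simp add: d_def sum_subtractf)
qed

text \<open>\<open>enat\<close> is well-ordered, so the infimum of a nonempty set is attained; a
  finite infimum excludes the empty set.\<close>

lemma Inf_eq_enat_D:
  assumes "Inf A = enat n"
  shows "enat n \<in> A"
proof -
  have "A \<noteq> {}" using assms by (auto simp: Inf_enat_def)
  then show ?thesis using wellorder_InfI[of _ A] assms by auto
qed

lemma window_ge_1: "1 \<le> window a b"
  by (simp add: window_def)

section \<open>The law of the transcript and the information complexity density\<close>

context protocol_execution
begin

lemma measure_inputs: "measure M {\<omega> \<in> space M. (inX \<omega>, inY \<omega>) \<in> S} = measure (measure_pmf P) S"
proof -
  interpret R: prob_space "pub p \<Otimes>\<^sub>M (priv1 p \<Otimes>\<^sub>M priv2 p)" by (intro prob_space_pair prob_space_coins)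
  have fst: "fst \<in> measurable M (measure_pmf P)" unfolding exec_space_def by measurable
  have "measure (measure_pmf P) S = measure (distr M (measure_pmf P) fst) S"
    unfolding exec_space_def by (simp add: R.distr_pair_fst)
  also have "\<dots> = measure M (fst -` S \<inter> space M)" by (rule measure_distr[OF fst]) simp
  also have "fst -` S \<inter> space M = {\<omega> \<in> space M. (inX \<omega>, inY \<omega>) \<in> S}"
    by (auto simp: inX_eq inY_eq)
  finally show ?thesis ..
qed

text \<open>Divided by \<open>prob1 t x\<close> this is the conditional probability of
  \<open>y\<close> given \<open>x\<close> and \<open>t\<close>, divided by \<open>prob2 t y\<close>
  that of \<open>x\<close> given \<open>y\<close> and \<open>t\<close>. The quotients become the
  weights \<open>r1\<close> and \<open>r2\<close>.\<close>

definition joint_prob :: "transcript \<Rightarrow> 'x \<Rightarrow> 'y \<Rightarrow> real" where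
  "joint_prob t x y = measure M {\<omega> \<in> space M. transcript_of p \<omega> = t \<and> inX \<omega> = x \<and> inY \<omega> = y}"

definition prob1 :: "transcript \<Rightarrow> 'x \<Rightarrow> real" where
  "prob1 t x = measure M {\<omega> \<in> space M. transcript_of p \<omega> = t \<and> inX \<omega> = x}"

definition prob2 :: "transcript \<Rightarrow> 'y \<Rightarrow> real" where
  "prob2 t y = measure M {\<omega> \<in> space M. transcript_of p \<omega> = t \<and> inY \<omega> = y}"

lemma sum_joint_prob: "(\<Sum>y\<in>UNIV. joint_prob t x y) \<le> prob1 t x" "(\<Sum>x\<in>UNIV. joint_prob t x y) \<le> prob2 t y"
proof -
  interpret M: prob_space M by (rule prob_space_exec)
  show "(\<Sum>y\<in>UNIV. joint_prob t x y) \<le> prob1 t x"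
    unfolding joint_prob_def prob1_def
    by (rule M.sum_measure_le_disjoint) (auto simp: disjoint_family_on_def)
  show "(\<Sum>x\<in>UNIV. joint_prob t x y) \<le> prob2 t y"
    unfolding joint_prob_def prob2_def
    by (rule M.sum_measure_le_disjoint) (auto simp: disjoint_family_on_def)
qed

lemma joint_prob_le: "joint_prob t x y \<le> prob1 t x" "joint_prob t x y \<le> prob2 t y"
  "joint_prob t x y \<le> pmf P (x, y)"
proof -
  interpret M: prob_space M by (rule prob_space_exec)
  show "joint_prob t x y \<le> prob1 t x" "joint_prob t x y \<le> prob2 t y"
    unfolding joint_prob_def prob1_def prob2_def by (auto intro!: M.finite_measure_mono)
  have "joint_prob t x y \<le> measure M {\<omega> \<in> space M. (inX \<omega>, inY \<omega>) \<in> {(x, y)}}"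
    unfolding joint_prob_def by (rule M.finite_measure_mono) auto
  then show "joint_prob t x y \<le> pmf P (x, y)"
    unfolding measure_inputs by (simp add: measure_pmf_single)
qed

lemma ic_eq:
  "ic P p t x y = log 2 ((joint_prob t x y / pmf P (x, y)) / (prob1 t x / pmf (map_pmf fst P) x)) +
    log 2 ((joint_prob t x y / pmf P (x, y)) / (prob2 t y / pmf (map_pmf snd P) y))"
proof -
  have "measure M {\<omega> \<in> space M. inX \<omega> = x \<and> inY \<omega> = y} = pmf P (x, y)"
    using measure_inputs[of "{(x, y)}"] by (simp add: measure_pmf_single)
  moreover have "measure M {\<omega> \<in> space M. inX \<omega> = x} = pmf (map_pmf fst P) x"
    using measure_inputs[of "{z. fst z = x}"] by (simp add: pmf_map vimage_def)
  moreover have "measure M {\<omega> \<in> space M. inY \<omega> = y} = pmf (map_pmf snd P) y"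
    using measure_inputs[of "{z. snd z = y}"] by (simp add: pmf_map vimage_def)
  ultimately show ?thesis
    unfolding ic_def Let_def cond_prob_def joint_prob_def prob1_def prob2_def by simp
qed

text \<open>This is the assumption on \<open>E\<close> in \<open>guessing_game\<close> with
  \<open>K = 2 powr (- l)\<close>. Positivity of \<open>joint_prob\<close> makes all arguments of
  the logarithms positive; their product exceeds \<open>2 powr l\<close>, and clearing denominators
  gives the claim.\<close>

lemma sq_le_of_ic_gt:
  assumes pos: "0 < joint_prob t x y" and ic: "l < ic P p t x y"
  shows "(pmf P (x, y))\<^sup>2 \<le> 2 powr (- l) * (pmf (map_pmf fst P) x * (joint_prob t x y / prob1 t x)) *
    (pmf (map_pmf snd P) y * (joint_prob t x y / prob2 t y))"
proof -
  define a q b c X Y where defs: "a = joint_prob t x y" "q = pmf P (x, y)" "b = prob1 t x" "c = prob2 t y"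
    "X = pmf (map_pmf fst P) x" "Y = pmf (map_pmf snd P) y"
  have "q \<le> X" "q \<le> Y"
    unfolding defs by (auto simp: pmf_map pmf.rep_eq intro!: measure_pmf.finite_measure_mono)
  then have pos: "0 < a" "0 < q" "0 < b" "0 < c" "0 < X" "0 < Y"
    using pos joint_prob_le[of t x y] unfolding defs by linarith+
  have "l < log 2 (((a / q) / (b / X)) * ((a / q) / (c / Y)))"
    using ic pos unfolding ic_eq defs[symmetric] by (subst log_mult) auto
  then have "2 powr l < ((a / q) / (b / X)) * ((a / q) / (c / Y))"
    using pos by (subst (asm) less_log_iff) auto
  then have "q\<^sup>2 * 2 powr l \<le> q\<^sup>2 * (((a / q) / (b / X)) * ((a / q) / (c / Y)))"
    by (intro mult_left_mono) auto
  also have "\<dots> = (X * (a / b)) * (Y * (a / c))"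
    using pos by (simp add: field_simps power2_eq_square)
  finally have "q\<^sup>2 * 2 powr l * 2 powr (- l) \<le> (X * (a / b)) * (Y * (a / c)) * 2 powr (- l)"
    by (intro mult_right_mono) auto
  then show ?thesis
    unfolding defs[symmetric] by (simp add: mult_ac flip: powr_add)
qed

text \<open>There are countably many triples of a transcript and inputs, so finitely many of those
  with large density carry all of their probability up to \<open>\<eta>\<close>.\<close>

lemma finite_typical_set:
  assumes "0 < \<eta>"
  obtains E where "finite E" "\<And>t x y. (t, x, y) \<in> E \<Longrightarrow> 0 < joint_prob t x y \<and> l < ic P p t x y"
    "measure M {\<omega> \<in> space M. at_outcome p (ic P p) \<omega> > l} - \<eta> \<le>
      measure M {\<omega> \<in> space M. (transcript_of p \<omega>, inX \<omega>, inY \<omega>) \<in> E}"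
proof -
  interpret M: prob_space M by (rule prob_space_exec)
  define Z where "Z \<omega> = (transcript_of p \<omega>, inX \<omega>, inY \<omega>)" for \<omega>
  have Z [measurable]: "Z \<in> measurable M (count_space UNIV)"
  proof -
    have "(\<lambda>\<omega>. (t, x, inY \<omega>)) \<in> measurable M (count_space UNIV)" for t x
      by (rule measurable_compose[OF measurable_exec_space(2)]) simp
    from measurable_compose_countable[OF this measurable_exec_space(1)]
    have "(\<lambda>\<omega>. (t, inX \<omega>, inY \<omega>)) \<in> measurable M (count_space UNIV)" for t .
    from measurable_compose_countable[OF this measurable_transcript_of]
    show ?thesis unfolding Z_def[abs_def] .
  qed
  have sets: "{\<omega> \<in> space M. Z \<omega> \<in> S} \<in> sets M" for S
    using measurable_sets[OF Z, of S] by (simp add: vimage_def Int_def conj_commute)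
  define D where "D = {(t, x, y). l < ic P p t x y}"
  \<comment> \<open>Finite initial segments of \<open>D\<close> in an enumeration of all
    triples.\<close>
  define D' where "D' n = D \<inter> to_nat -` {..<n}" for n
  define S where "S n = {\<omega> \<in> space M. Z \<omega> \<in> D' n}" for n
  have fin: "finite (D' n)" for n
    unfolding D'_def by (intro finite_Int disjI2 finite_vimageI) auto
  have "(\<lambda>n. measure M (S n)) \<longlonglongrightarrow> measure M (\<Union>n. S n)"
    by (rule M.finite_Lim_measure_incseq) (auto simp: S_def D'_def sets intro!: incseq_SucI)
  also have "(\<Union>n. S n) = {\<omega> \<in> space M. at_outcome p (ic P p) \<omega> > l}"
    by (auto simp: S_def D'_def D_def Z_def at_outcome_def)
  finally have "\<forall>\<^sub>F n in sequentially. measure M {\<omega> \<in> space M. at_outcome p (ic P p) \<omega> > l} - \<eta> < measure M (S n)"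
    by (rule order_tendstoD) (use assms in simp)
  then obtain n where n: "measure M {\<omega> \<in> space M. at_outcome p (ic P p) \<omega> > l} - \<eta> < measure M (S n)"
    by (auto simp: eventually_sequentially)
  \<comment> \<open>Dropping null triples changes no probability and gives the strict positivity
    required by \<open>sq_le_of_ic_gt\<close>.\<close>
  define E where "E = {z \<in> D' n. measure M {\<omega> \<in> space M. Z \<omega> = z} \<noteq> 0}"
  have sum_eq: "measure M {\<omega> \<in> space M. Z \<omega> \<in> F} = (\<Sum>z\<in>F. measure M {\<omega> \<in> space M. Z \<omega> = z})" if "finite F" for F
  proof -
    have "{\<omega> \<in> space M. Z \<omega> \<in> F} = (\<Union>z\<in>F. {\<omega> \<in> space M. Z \<omega> = z})" by auto
    then show ?thesis
      using that sets[of "{_}"] by (simp only:) (intro M.finite_measure_finite_Union, auto simp: disjoint_family_on_def)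
  qed
  show ?thesis
  proof
    show "finite E" using fin by (simp add: E_def)
    have "measure M (S n) = measure M {\<omega> \<in> space M. Z \<omega> \<in> E}"
      unfolding S_def sum_eq[OF fin] sum_eq[OF \<open>finite E\<close>]
      by (rule sum.mono_neutral_right) (auto simp: E_def fin)
    then show "measure M {\<omega> \<in> space M. at_outcome p (ic P p) \<omega> > l} - \<eta> \<le>
      measure M {\<omega> \<in> space M. (transcript_of p \<omega>, inX \<omega>, inY \<omega>) \<in> E}"
      using n by (simp add: Z_def)
    show "0 < joint_prob t x y \<and> l < ic P p t x y" if "(t, x, y) \<in> E" for t x y
      using that by (auto simp: E_def D'_def D_def joint_prob_def Z_def zero_less_measure_iff)
  qed
qed

end

section \<open>The lower bound on the length of a simulation\<close>

text \<open>One \<open>\<eta>\<close> pays for the passage to a finite set \<open>E\<close>, and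
  \<open>\<epsilon>\<close> for the simulation error. With the other \<open>\<eta>\<close> the
  simulation must still reconstruct a triple of \<open>E\<close>, so \<open>prob_recover_le\<close>
  yields \<open>\<eta> \<le> 2 powr ((L - l) / 2)\<close>.\<close>

lemma simulation_length_ge:
  fixes P :: "('x::finite \<times> 'y::finite) pmf"
    and \<pi> :: "('x, 'y, 'u, 'a, 'b) protocol" and s :: "('x, 'y, 'v, 'c, 'd) protocol"
  assumes \<pi>: "interactive_protocol P \<pi>" and s: "simulates P \<pi> \<epsilon> s" and L: "protocol_length P s = enat L"
    and \<eta>: "0 < \<eta>" and l: "\<epsilon> + 2 * \<eta> \<le> \<P>(\<omega> in exec_space P \<pi>. at_outcome \<pi> (ic P \<pi>) \<omega> > l)"
  shows "l \<le> L + 2 * log 2 (1 / \<eta>)"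
proof -
  interpret \<pi>: protocol_execution P \<pi> by unfold_locales (rule \<pi>)
  interpret s: protocol_execution P s by unfold_locales (use s in \<open>simp add: simulates_def\<close>)
  interpret M: prob_space "exec_space P \<pi>" by (rule \<pi>.prob_space_exec)
  interpret N: prob_space "exec_space P s" by (rule s.prob_space_exec)
  obtain F1 F2 where F1: "recoverable1 P s F1" and F2: "recoverable2 P s F2"
    and d: "d_var
          (distr (exec_space P \<pi>) (count_space UNIV)
             (\<lambda>\<omega>. (transcript_of \<pi> \<omega>, transcript_of \<pi> \<omega>, inX \<omega>, inY \<omega>)))
          (distr (exec_space P s) (count_space UNIV)
             (\<lambda>\<omega>. (F1 \<omega>, F2 \<omega>, inX \<omega>, inY \<omega>))) \<le> \<epsilon>" (is "d_var (distr _ _ ?f) (distr _ _ ?g) \<le> _")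
    using s unfolding simulates_def by blast
  have quad: "(\<lambda>\<omega>. (G1 \<omega>, G2 \<omega>, inX \<omega>, inY \<omega>)) \<in> measurable (exec_space P p) (count_space UNIV)"
    if "G1 \<in> measurable (exec_space P p) (count_space UNIV)" "G2 \<in> measurable (exec_space P p) (count_space UNIV)"
    for G1 G2 :: "('x, 'y, 'e, 'f, 'g) outcome \<Rightarrow> transcript" and p :: "('x, 'y, 'e, 'f, 'g) protocol"
  proof -
    have "(\<lambda>\<omega>. (t, t', x, inY \<omega>)) \<in> measurable (exec_space P p) (count_space UNIV)" for t t' :: transcript and x :: 'x
      by (rule measurable_compose[OF measurable_exec_space(2)]) simp
    from measurable_compose_countable[OF this measurable_exec_space(1)]
    have 1: "(\<lambda>\<omega>. (t, t', inX \<omega>, inY \<omega>)) \<in> measurable (exec_space P p) (count_space UNIV)" for t t' :: transcript .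
    have "(\<lambda>\<omega>. (t, G2 \<omega>, inX \<omega>, inY \<omega>)) \<in> measurable (exec_space P p) (count_space UNIV)" for t :: transcript
      by (rule measurable_compose_countable[where f = "\<lambda>t' \<omega>. (t, t', inX \<omega>, inY \<omega>)" and g = G2]) (rule 1, rule that(2))
    then show ?thesis
      by (rule measurable_compose_countable[where f = "\<lambda>t \<omega>. (t, G2 \<omega>, inX \<omega>, inY \<omega>)" and g = G1]) (rule that(1))
  qed
  have f: "?f \<in> measurable (exec_space P \<pi>) (count_space UNIV)"
    by (intro quad \<pi>.measurable_transcript_of)
  have g: "?g \<in> measurable (exec_space P s) (count_space UNIV)"
    using F1 F2 by (intro quad) (simp_all add: recoverable1_def recoverable2_def)
  obtain E where E: "finite E" "\<And>t x y. (t, x, y) \<in> E \<Longrightarrow> 0 < \<pi>.joint_prob t x y \<and> l < ic P \<pi> t x y"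
    "measure (exec_space P \<pi>) {\<omega> \<in> space (exec_space P \<pi>). at_outcome \<pi> (ic P \<pi>) \<omega> > l} - \<eta> \<le>
      measure (exec_space P \<pi>) {\<omega> \<in> space (exec_space P \<pi>). (transcript_of \<pi> \<omega>, inX \<omega>, inY \<omega>) \<in> E}"
    using \<pi>.finite_typical_set[OF \<eta>] by blast
  \<comment> \<open>On the diagonal both reconstructions have to equal the same transcript.\<close>
  let ?Z = "(\<lambda>(t, x, y). (t, t, x, y)) ` E"
  have Zf: "?f -` ?Z \<inter> space (exec_space P \<pi>) =
      {\<omega> \<in> space (exec_space P \<pi>). (transcript_of \<pi> \<omega>, inX \<omega>, inY \<omega>) \<in> E}" by force
  have Zg: "?g -` ?Z \<inter> space (exec_space P s) =
      {\<omega> \<in> space (exec_space P s). (F1 \<omega>, inX \<omega>, inY \<omega>) \<in> E \<and> F2 \<omega> = F1 \<omega>}" by force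
  have "enat L \<in> {enat l | l. AE \<omega> in exec_space P s. length (concat (transcript_of s \<omega>)) \<le> l}"
    using L unfolding protocol_length_def by (rule Inf_eq_enat_D)
  then have len: "AE \<omega> in exec_space P s. length (concat (transcript_of s \<omega>)) \<le> L" by simp
  have "measure (exec_space P \<pi>) {\<omega> \<in> space (exec_space P \<pi>). (transcript_of \<pi> \<omega>, inX \<omega>, inY \<omega>) \<in> E} -
      measure (exec_space P s) {\<omega> \<in> space (exec_space P s). (F1 \<omega>, inX \<omega>, inY \<omega>) \<in> E \<and> F2 \<omega> = F1 \<omega>} =
    measure (distr (exec_space P \<pi>) (count_space UNIV) ?f) ?Z - measure (distr (exec_space P s) (count_space UNIV) ?g) ?Z"
    by (simp add: measure_distr[OF f] measure_distr[OF g] Zf Zg)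
  also have "\<dots> \<le> \<epsilon>"
    using E(1) by (intro order_trans[OF measure_diff_le_d_var d] M.prob_space_distr[OF f] N.prob_space_distr[OF g]) simp_all
  finally have 1: "\<eta> \<le> measure (exec_space P s)
      {\<omega> \<in> space (exec_space P s). (F1 \<omega>, inX \<omega>, inY \<omega>) \<in> E \<and> F2 \<omega> = F1 \<omega>}"
    using E(3) l by linarith
  also have "\<dots> \<le> sqrt (2 powr (- l)) * sqrt 2 ^ L"
  proof (rule s.prob_recover_le[OF _ len F1 F2 E(1)])
    show "self_delimiting P s" using s by (simp add: simulates_def)
    have nonneg: "0 \<le> \<pi>.joint_prob t x y" "0 \<le> \<pi>.prob1 t x" "0 \<le> \<pi>.prob2 t y" for t x y
      by (simp_all add: \<pi>.joint_prob_def \<pi>.prob1_def \<pi>.prob2_def)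
    show "0 \<le> \<pi>.joint_prob t x y / \<pi>.prob1 t x" "0 \<le> \<pi>.joint_prob t x y / \<pi>.prob2 t y" for t x y
      by (simp_all add: nonneg)
    \<comment> \<open>If the denominator vanishes, the quotients are 0 by convention and the bound
      still holds.\<close>
    show "(\<Sum>y\<in>UNIV. \<pi>.joint_prob t x y / \<pi>.prob1 t x) \<le> 1" for t x
      unfolding sum_divide_distrib[symmetric]
      using \<pi>.sum_joint_prob(1)[where t = t and x = x] nonneg(2)[of t x] by (simp add: divide_le_eq_1) linarith
    show "(\<Sum>x\<in>UNIV. \<pi>.joint_prob t x y / \<pi>.prob2 t y) \<le> 1" for t y
      unfolding sum_divide_distrib[symmetric]
      using \<pi>.sum_joint_prob(2)[where t = t and y = y] nonneg(3)[of t y] by (simp add: divide_le_eq_1) linarith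
    show "(pmf P (x, y))\<^sup>2 \<le> 2 powr (- l) * (pmf (map_pmf fst P) x * (\<pi>.joint_prob t x y / \<pi>.prob1 t x)) *
        (pmf (map_pmf snd P) y * (\<pi>.joint_prob t x y / \<pi>.prob2 t y))" if "(t, x, y) \<in> E" for t x y
      using E(2)[OF that] by (intro \<pi>.sq_le_of_ic_gt) auto
  qed simp
  also have "\<dots> = 2 powr ((L - l) / 2)"
    by (simp add: powr_half_sqrt[symmetric] powr_powr powr_power flip: powr_add) (simp add: field_simps)
  finally have "log 2 \<eta> \<le> log 2 (2 powr ((L - l) / 2))"
    using \<eta> by (subst log_le_cancel_iff) auto
  then show ?thesis using \<eta> by (simp add: log_divide)
qed

theorem theorem1:
  fixes P :: "('x::finite \<times> 'y::finite) pmf"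
    and \<pi> :: "('x, 'y, 'u, 'a, 'b) protocol"
    and \<epsilon> \<eta> \<epsilon>_tail \<epsilon>' l' :: real
    and lmin lmax \<Lambda> :: "nat \<Rightarrow> real"
    and \<zeta> :: "nat \<Rightarrow> ('x, 'y, 'u, 'a, 'b) outcome \<Rightarrow> real"
  assumes "0 \<le> \<epsilon>" and "\<epsilon> < 1"
    and "interactive_protocol P \<pi>" and "private_coin \<pi>"
    and "0 < \<eta>" and "\<eta> < 1 / 3"
    and "\<And>i. i \<in> {1, 2, 3} \<Longrightarrow> lmin i \<le> lmax i"
    and "0 \<le> \<epsilon>_tail"
    and "\<zeta> 1 = (\<lambda>\<omega>. h_XY P (inX \<omega>) (inY \<omega>))"
    and "\<zeta> 2 = at_outcome \<pi> (h_X_given P \<pi>)"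
    and "\<zeta> 3 = at_outcome \<pi> (h_sym_diff P \<pi>)"
    and "(\<Sum>i\<in>{1, 2, 3}. \<P>(\<omega> in exec_space P \<pi>. \<zeta> i \<omega> \<notin> {lmin i..lmax i})) \<le> \<epsilon>_tail"
    and "\<And>i. i \<in> {1, 2, 3} \<Longrightarrow> \<Lambda> i = window (lmin i) (lmax i)"
    and "\<epsilon>' = \<epsilon>_tail + 2 * \<eta>"
    and "l' = 2 * log 2 (\<Lambda> 1 * \<Lambda> 3) + log 2 (\<Lambda> 2) - log 2 (1 - 3 * \<eta>) + 9 * log 2 (1 / \<eta>) + 3"
  shows "ereal_of_enat (D_sim P \<pi> \<epsilon>) \<ge>
    Sup {ereal l | l. \<P>(\<omega> in exec_space P \<pi>. at_outcome \<pi> (ic P \<pi>) \<omega> > l) \<ge> \<epsilon> + \<epsilon>'} - ereal l'"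
proof (cases "D_sim P \<pi> \<epsilon>")
  \<comment> \<open>If \<open>D_sim\<close> is infinite, the inequality is trivial. Otherwise the
    minimum is attained by a simulation of length \<open>L\<close>.\<close>
  case (enat L)
  let ?D = "{protocol_length P s | s :: ('x, 'y, real, real, real) protocol. simulates P \<pi> \<epsilon> s}"
  have "enat L \<in> ?D" using enat unfolding D_sim_def by (rule Inf_eq_enat_D)
  then obtain s :: "('x, 'y, real, real, real) protocol"
    where s: "simulates P \<pi> \<epsilon> s" "protocol_length P s = enat L" by auto
  have \<Lambda>: "1 \<le> \<Lambda> 1" "1 \<le> \<Lambda> 2" "1 \<le> \<Lambda> 3" using assms(13) window_ge_1 by simp_all
  then have "1 * 1 \<le> \<Lambda> 1 * \<Lambda> 3" by (intro mult_mono) auto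
  then have "0 \<le> log 2 (\<Lambda> 1 * \<Lambda> 3)" "0 \<le> log 2 (\<Lambda> 2)" using \<Lambda> by simp_all
  moreover have "log 2 (1 - 3 * \<eta>) \<le> 0" "0 \<le> log 2 (1 / \<eta>)"
    using assms(5,6) by (simp_all add: log_le_zero_cancel_iff zero_le_log_cancel_iff)
  \<comment> \<open>The nine logarithms of \<open>1 / \<eta>\<close> contain the two that are
    wanted; every other term of \<open>l'\<close> is non-negative.\<close>
  ultimately have l': "2 * log 2 (1 / \<eta>) \<le> l'" unfolding assms(15) by linarith
  have "Sup {ereal l | l. \<P>(\<omega> in exec_space P \<pi>. at_outcome \<pi> (ic P \<pi>) \<omega> > l) \<ge> \<epsilon> + \<epsilon>'} \<le> ereal (L + l')"
  \<comment> \<open>It suffices to bound each \<open>l\<close> separately, which also covers an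
    empty set with supremum \<open>-\<infinity>\<close>.\<close>
  proof (rule Sup_least, clarify)
    fix l assume "\<epsilon> + \<epsilon>' \<le> \<P>(\<omega> in exec_space P \<pi>. at_outcome \<pi> (ic P \<pi>) \<omega> > l)"
    then have "\<epsilon> + 2 * \<eta> \<le> \<P>(\<omega> in exec_space P \<pi>. at_outcome \<pi> (ic P \<pi>) \<omega> > l)"
      using assms(8,14) by linarith
    from simulation_length_ge[OF assms(3) s assms(5) this] l'
    show "ereal l \<le> ereal (L + l')" by simp
  qed
  then have "Sup {ereal l | l. \<P>(\<omega> in exec_space P \<pi>. at_outcome \<pi> (ic P \<pi>) \<omega> > l) \<ge> \<epsilon> + \<epsilon>'} - ereal l' \<le> ereal (L + l') - ereal l'"
    by (rule ereal_minus_mono) simp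
  then show ?thesis by (simp add: enat)
qed simp

end
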